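(* Let $\alpha \in \mathbb{R} \setminus \{0\}$ and let $m,n \geq 2$ be integers. (1) If $\alpha \in 2\mathbb{N} \cup [n-2,\infty)$, then $\phi_\alpha^{[m]}[H] \in \mathbb{P}_{mn}(\mathbb{C})$ for all $H = (H_{st})_{s,t=1}^n \in \mathbb{P}_{mn}(\mathbb{C})$ whose blocks $H_{st}$ are $m \times m$ Hermitian matrices that pairwise commute. If $\alpha \notin 2\mathbb{N} \cup [n-2,\infty)$, there exist real symmetric $m \times m$ matrices $H_{st}$ such that $H = (H_{st})_{s,t=1}^n \in \mathbb{P}_{mn}(\mathbb{R})$ and the blocks $H_{st}$ pairwise commute, but $\phi_\alpha^{[m]}[H] \notin \mathbb{P}_{mn}(\mathbb{R})$. (2) If $\alpha \in (-1+2\mathbb{N}) \cup [n-2,\infty)$, then $\psi_\alpha^{[m]}[H] \in \mathbb{P}_{mn}(\mathbb{C})$ for all $H = (H_{st})_{s,t=1}^n \in \mathbb{P}_{mn}(\mathbb{C})$ whose blocks $H_{st}$ are $m \times m$ Hermitian matrices that pairwise commute. If $\alpha \notin (-1+2\mathbb{N}) \cup [n-2,\infty)$, there exist real symmetric $m \times m$ matrices $H_{st}$ such that $H = (H_{st})_{s,t=1}^n \in \mathbb{P}_{mn}(\mathbb{R})$ and the blocks $H_{st}$ pairwise commute, but $\psi_\alpha^{[m]}[H] \notin \mathbb{P}_{mn}(\mathbb{R})$.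
   Context: $\mathbb{N} = \{1,2,3,\dots\}$. For $S \subset \mathbb{C}$, $\mathbb{P}_N(S)$ denotes the set of $N \times N$ Hermitian positive semidefinite matrices with entries in $S$. For $\alpha \in \mathbb{R}$ and real $x \neq 0$: $\phi_\alpha(x) := |x|^\alpha$ and $\psi_\alpha(x) := \operatorname{sgn}(x)|x|^\alpha$; also $\phi_\alpha(0) = \psi_\alpha(0) := 0$. For $f:\mathbb{R}\to\mathbb{R}$ and a Hermitian matrix $B$, $f(B)$ is defined by spectral calculus (apply $f$ to the eigenvalues in a spectral decomposition of $B$). For a block matrix $H = (H_{st})_{s,t=1}^n$ with $m \times m$ Hermitian blocks, $f^{[m]}[H] := (f(H_{st}))_{s,t=1}^n$. *)

theory Defs
  imports Complex_Main "Jordan_Normal_Form.Schur_Decomposition"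
begin

text \<open>
  Matrices are those of \<open>Jordan_Normal_Form\<close>, with complex entries, so that the sizes
  \<open>m\<close>, \<open>n\<close>, \<open>m * n\<close> are natural numbers. Real matrices are complex matrices all of whose entries
  lie in \<open>\<real>\<close>.
\<close>

definition hermitian_mats :: "nat \<Rightarrow> complex mat set" where
  "hermitian_mats N = {A \<in> carrier_mat N N. mat_adjoint A = A}"

definition real_symmetric_mats :: "nat \<Rightarrow> complex mat set" where
  "real_symmetric_mats N = {A \<in> carrier_mat N N. elements_mat A \<subseteq> \<real> \<and> transpose_mat A = A}"

text \<open>\<open>psd_mats N S\<close> is $\mathbb{P}_N(S)$; for Hermitian \<open>A\<close> the form $v^* A v$ is real.\<close>

definition psd_mats :: "nat \<Rightarrow> complex set \<Rightarrow> complex mat set" where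
  "psd_mats N S = {A \<in> hermitian_mats N. elements_mat A \<subseteq> S \<and>
     (\<forall>v \<in> carrier_vec N. 0 \<le> Re ((A *\<^sub>v v) \<bullet>c v))}"

definition unitary_mats :: "nat \<Rightarrow> complex mat set" where
  "unitary_mats N = {U \<in> carrier_mat N N.
     U * mat_adjoint U = 1\<^sub>m N \<and> mat_adjoint U * U = 1\<^sub>m N}"

definition real_diag :: "nat \<Rightarrow> (nat \<Rightarrow> real) \<Rightarrow> complex mat" where
  "real_diag N d = mat_diag N (\<lambda>i. complex_of_real (d i))"

definition spectral_decomp :: "complex mat \<Rightarrow> complex mat \<Rightarrow> (nat \<Rightarrow> real) \<Rightarrow> bool" where
  "spectral_decomp B U d \<longleftrightarrow> U \<in> unitary_mats (dim_row B) \<and>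
     B = U * real_diag (dim_row B) d * mat_adjoint U"

text \<open>
  The spectral calculus \<open>f(B)\<close>, meaningful for Hermitian \<open>B\<close>. The result does not depend on the
  chosen decomposition: see \<open>spectral_calc_eq\<close> below.
\<close>

definition spectral_calc :: "(real \<Rightarrow> real) \<Rightarrow> complex mat \<Rightarrow> complex mat" where
  "spectral_calc f B = (let (U, d) = (SOME (U, d). spectral_decomp B U d)
     in U * real_diag (dim_row B) (f \<circ> d) * mat_adjoint U)"

text \<open>The \<open>n * m\<close>-dimensional matrix with \<open>m\<close>-by-\<open>m\<close> blocks \<open>H s t\<close> for \<open>s, t < n\<close>.\<close>

definition block_mat :: "nat \<Rightarrow> nat \<Rightarrow> (nat \<Rightarrow> nat \<Rightarrow> complex mat) \<Rightarrow> complex mat" where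
  "block_mat m n H = mat (m * n) (m * n)
     (\<lambda>(i, j). H (i div m) (j div m) $$ (i mod m, j mod m))"

definition block_calc ::
    "(real \<Rightarrow> real) \<Rightarrow> nat \<Rightarrow> nat \<Rightarrow> (nat \<Rightarrow> nat \<Rightarrow> complex mat) \<Rightarrow> complex mat" where
  "block_calc f m n H = block_mat m n (\<lambda>s t. spectral_calc f (H s t))"

definition blocks_in :: "nat \<Rightarrow> (nat \<Rightarrow> nat \<Rightarrow> complex mat) \<Rightarrow> complex mat set \<Rightarrow> bool" where
  "blocks_in n H \<M> \<longleftrightarrow> (\<forall>s<n. \<forall>t<n. H s t \<in> \<M>)"

definition blocks_commute :: "nat \<Rightarrow> (nat \<Rightarrow> nat \<Rightarrow> complex mat) \<Rightarrow> bool" where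
  "blocks_commute n H \<longleftrightarrow>
     (\<forall>s<n. \<forall>t<n. \<forall>u<n. \<forall>v<n. H s t * H u v = H u v * H s t)"

definition phi :: "real \<Rightarrow> real \<Rightarrow> real" where
  "phi \<alpha> x = (if x = 0 then 0 else \<bar>x\<bar> powr \<alpha>)"

definition psi :: "real \<Rightarrow> real \<Rightarrow> real" where
  "psi \<alpha> x = (if x = 0 then 0 else sgn x * \<bar>x\<bar> powr \<alpha>)"

lemma mat_adjoint_carrier: "U \<in> carrier_mat N N \<Longrightarrow> mat_adjoint U \<in> carrier_mat N N"
  unfolding mat_adjoint_def by auto

lemma real_diag_carrier: "real_diag N d \<in> carrier_mat N N"
  unfolding real_diag_def by simp

lemma real_diag_intertwine:
  assumes W: "W \<in> carrier_mat N N"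
    and eq: "W * real_diag N d = real_diag N e * W"
  shows "W * real_diag N (f \<circ> d) = real_diag N (f \<circ> e) * W"
proof -
  have ent: "W $$ (i, j) * complex_of_real (d j) = complex_of_real (e i) * W $$ (i, j)"
    if "i < N" "j < N" for i j
    using arg_cong[OF eq, of "\<lambda>M. M $$ (i, j)"] that
    by (simp add: real_diag_def mat_diag_mult_left[OF W] mat_diag_mult_right[OF W])
  have "W $$ (i, j) * complex_of_real (f (d j)) = complex_of_real (f (e i)) * W $$ (i, j)"
    if ij: "i < N" "j < N" for i j
  proof (cases "W $$ (i, j) = 0")
    case False
    then have "d j = e i" using ent[OF ij] by simp
    then show ?thesis by simp
  qed simp
  then show ?thesis
    by (auto simp: real_diag_def mat_diag_mult_left[OF W] mat_diag_mult_right[OF W] o_def)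
qed

lemma spectral_decomp_unique:
  assumes "spectral_decomp B U d" and "spectral_decomp B V e"
  shows "U * real_diag (dim_row B) (f \<circ> d) * mat_adjoint U =
         V * real_diag (dim_row B) (f \<circ> e) * mat_adjoint V"
proof -
  define N where "N = dim_row B"
  let ?U' = "mat_adjoint U" and ?V' = "mat_adjoint V"
  have c: "U \<in> carrier_mat N N" "V \<in> carrier_mat N N"
      "?U' \<in> carrier_mat N N" "?V' \<in> carrier_mat N N"
    and u: "U * ?U' = 1\<^sub>m N" "?U' * U = 1\<^sub>m N" "V * ?V' = 1\<^sub>m N" "?V' * V = 1\<^sub>m N"
    and B: "U * real_diag N d * ?U' = V * real_diag N e * ?V'"
    using assms mat_adjoint_carrier
    unfolding spectral_decomp_def unitary_mats_def N_def by auto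
  have conj: "?V' * (U * D * ?U') * U = ?V' * U * D"
      "?V' * (V * D * ?V') * U = D * (?V' * U)" if D: "D \<in> carrier_mat N N" for D
  proof -
    have "?V' * (U * D * ?U') * U = ?V' * U * D * (?U' * U)"
      using c D by (simp add: assoc_mult_mat[of _ N N _ N _ N] mult_carrier_mat[of _ N N _ N])
    then show "?V' * (U * D * ?U') * U = ?V' * U * D"
      using c D u by simp
    have "?V' * (V * D * ?V') * U = (?V' * V) * D * (?V' * U)"
      using c D by (simp add: assoc_mult_mat[of _ N N _ N _ N] mult_carrier_mat[of _ N N _ N])
    then show "?V' * (V * D * ?V') * U = D * (?V' * U)"
      using c D u by simp
  qed
  have "?V' * U * real_diag N d = real_diag N e * (?V' * U)"
    using conj[OF real_diag_carrier] B by metis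
  then have fW: "?V' * U * real_diag N (f \<circ> d) = real_diag N (f \<circ> e) * (?V' * U)"
    using c by (intro real_diag_intertwine) auto
  have D: "real_diag N x \<in> carrier_mat N N" for x by (rule real_diag_carrier)
  have "U * real_diag N (f \<circ> d) * ?U' = (V * ?V') * U * real_diag N (f \<circ> d) * ?U'"
    using c u by simp
  also have "\<dots> = V * (?V' * U * real_diag N (f \<circ> d)) * ?U'"
    using c D by (simp add: assoc_mult_mat[of _ N N _ N _ N] mult_carrier_mat[of _ N N _ N])
  also have "\<dots> = V * (real_diag N (f \<circ> e) * (?V' * U)) * ?U'"
    by (simp only: fW)
  also have "\<dots> = V * real_diag N (f \<circ> e) * ?V' * (U * ?U')"
    using c D by (simp add: assoc_mult_mat[of _ N N _ N _ N] mult_carrier_mat[of _ N N _ N])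
  also have "\<dots> = V * real_diag N (f \<circ> e) * ?V'"
    using c D u by simp
  finally show ?thesis unfolding N_def .
qed

lemma spectral_calc_eq:
  assumes "spectral_decomp B U d"
  shows "spectral_calc f B = U * real_diag (dim_row B) (f \<circ> d) * mat_adjoint U"
proof -
  obtain V e where Ve: "(SOME (U, d). spectral_decomp B U d) = (V, e)"
    by (cases "SOME (U, d). spectral_decomp B U d")
  have "case (SOME (U, d). spectral_decomp B U d) of (U, d) \<Rightarrow> spectral_decomp B U d"
    by (rule someI[of "\<lambda>(U, d). spectral_decomp B U d" "(U, d)"]) (simp add: assms)
  then have "spectral_decomp B V e" using Ve by simp
  from spectral_decomp_unique[OF this assms] show ?thesis
    by (simp add: spectral_calc_def Ve)
qed

end

theory Submission
  imports Defs "Jordan_Normal_Form.Spectral_Radius"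
begin

text \<open>
  Commuting Hermitian blocks \<open>H s t\<close> are diagonalized by one unitary matrix \<open>U\<close>. In the
  coordinates given by \<open>U\<close> the block matrix falls apart into \<open>m\<close> real symmetric arrays of
  size \<open>n\<close>: the array number \<open>c\<close> collects the \<open>c\<close>-th eigenvalues of all blocks. The block
  matrix is positive semidefinite iff each of these arrays is, and the block calculus of \<open>f\<close>
  applies \<open>f\<close> entrywise to each array (\<open>block_mat_psd_iff\<close>). Conversely every real array \<open>A\<close> is
  realized by the scalar blocks \<open>A s t \<cdot> 1\<close>. So the claim is equivalent to the one about
  entrywise powers of real \<open>n\<close>-by-\<open>n\<close> positive semidefinite arrays.

  That integer powers of the right parity preserve positivity is the Schur product theorem.
  For exponents \<open>\<alpha> \<ge> n - 2\<close> the argument of FitzGerald and Horn is an induction on \<open>n\<close>. Split off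
  from \<open>A\<close> the rank one array \<open>\<zeta> \<zeta>\<^sup>T\<close> that agrees with \<open>A\<close> in the last row and column; the
  remainder \<open>A - \<zeta> \<zeta>\<^sup>T\<close> is positive semidefinite of size \<open>n - 1\<close>. Both power functions are
  multiplicative, so they map \<open>\<zeta> \<zeta>\<^sup>T\<close> to an array of the same form. Along the segment from
  \<open>\<zeta> \<zeta>\<^sup>T\<close> to \<open>A\<close> the derivative of the entrywise power is the Schur product of
  \<open>A - \<zeta> \<zeta>\<^sup>T\<close> with \<open>\<alpha>\<close> times an entrywise power with exponent \<open>\<alpha> - 1\<close>, where differentiation has
  exchanged the even and the odd power function; it is positive semidefinite by induction
  (\<open>pos_semidef_powers_strict\<close>). The boundary exponent \<open>n - 2\<close> follows by continuity in \<open>\<alpha>\<close>.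

  For the remaining exponents, a negative power reverses the order of \<open>1\<close> and \<open>2\<close> and so destroys
  a diagonally dominant array. Against positive exponents \<open>A i j = 1 + h x\<^sub>i x\<^sub>j\<close> is used with a
  vector \<open>v\<close> that annihilates all polynomials of low degree in the nodes \<open>x\<^sub>i\<close>. If \<open>\<alpha>\<close> is not an
  integer, then the first surviving Taylor coefficient of \<open>(1 + t) powr \<alpha>\<close> is negative
  (\<open>nonint_power_not_pos_semidef\<close>). If \<open>\<alpha> = k\<close> is an integer of the wrong parity, the function is
  \<open>sgn t * t ^ k\<close>, which differs from a polynomial only at negative arguments; exactly one pair of
  nodes produces such an entry, and the two weights at this pair can be chosen freely
  (\<open>sgn_power_not_pos_semidef\<close>).
\<close>

section \<open>Positive semidefinite real arrays\<close>

text \<open>Arrays are functions, so that one array can be tested on index sets of different sizes.\<close>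
definition quad_form :: "nat \<Rightarrow> (nat \<Rightarrow> nat \<Rightarrow> real) \<Rightarrow> (nat \<Rightarrow> real) \<Rightarrow> real" where
  "quad_form n A x = (\<Sum>i<n. \<Sum>j<n. A i j * x i * x j)"

definition pos_semidef :: "nat \<Rightarrow> (nat \<Rightarrow> nat \<Rightarrow> real) \<Rightarrow> bool" where
  "pos_semidef n A \<longleftrightarrow> (\<forall>i<n. \<forall>j<n. A i j = A j i) \<and> (\<forall>x. 0 \<le> quad_form n A x)"

lemma pos_semidefI:
  assumes "\<And>i j. i < n \<Longrightarrow> j < n \<Longrightarrow> A i j = A j i" "\<And>x. 0 \<le> quad_form n A x"
  shows "pos_semidef n A"
  using assms by (simp add: pos_semidef_def)

lemma pos_semidef_sym: "pos_semidef n A \<Longrightarrow> i < n \<Longrightarrow> j < n \<Longrightarrow> A i j = A j i"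
  by (simp add: pos_semidef_def)

lemma pos_semidef_quad_form: "pos_semidef n A \<Longrightarrow> 0 \<le> quad_form n A x"
  by (simp add: pos_semidef_def)

lemma quad_form_cong:
  assumes "\<And>i j. i < n \<Longrightarrow> j < n \<Longrightarrow> A i j = B i j" "\<And>i. i < n \<Longrightarrow> x i = y i"
  shows "quad_form n A x = quad_form n B y"
  unfolding quad_form_def using assms by (intro sum.cong) auto

lemma pos_semidef_cong:
  assumes "\<And>i j. i < n \<Longrightarrow> j < n \<Longrightarrow> A i j = B i j"
  shows "pos_semidef n A \<longleftrightarrow> pos_semidef n B"
  unfolding pos_semidef_def using assms quad_form_cong[of n A B x x for x] by auto

lemma quad_form_add: "quad_form n (\<lambda>i j. A i j + B i j) x = quad_form n A x + quad_form n B x"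
  by (simp add: quad_form_def algebra_simps sum.distrib)

lemma quad_form_cmult: "quad_form n (\<lambda>i j. c * A i j) x = c * quad_form n A x"
  by (simp add: quad_form_def algebra_simps sum_distrib_left)

lemma quad_form_rank_one: "quad_form n (\<lambda>i j. u i * u j) x = (\<Sum>i<n. u i * x i)\<^sup>2"
  by (simp add: quad_form_def power2_eq_square sum_product algebra_simps)

lemma pos_semidef_add:
  "pos_semidef n A \<Longrightarrow> pos_semidef n B \<Longrightarrow> pos_semidef n (\<lambda>i j. A i j + B i j)"
  by (simp add: pos_semidef_def quad_form_add)

lemma pos_semidef_cmult: "0 \<le> c \<Longrightarrow> pos_semidef n A \<Longrightarrow> pos_semidef n (\<lambda>i j. c * A i j)"
  by (simp add: pos_semidef_def quad_form_cmult)

lemma pos_semidef_rank_one: "pos_semidef n (\<lambda>i j. u i * u j)"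
  by (simp add: pos_semidef_def quad_form_rank_one mult.commute)

lemma quad_form_Suc:
  assumes "\<And>i. i < n \<Longrightarrow> A n i = A i n"
  shows "quad_form (Suc n) A x
    = quad_form n A x + 2 * x n * (\<Sum>i<n. A i n * x i) + A n n * (x n)\<^sup>2"
proof -
  have "quad_form (Suc n) A x = quad_form n A x + (\<Sum>i<n. A i n * x i * x n)
      + (\<Sum>i<n. A n i * x n * x i) + A n n * x n * x n"
    by (simp add: quad_form_def sum.distrib)
  moreover have "(\<Sum>i<n. A n i * x n * x i) = (\<Sum>i<n. A i n * x i * x n)"
    by (intro sum.cong) (auto simp: assms)
  moreover have "(\<Sum>i<n. A i n * x i * x n) = x n * (\<Sum>i<n. A i n * x i)"
    by (simp add: sum_distrib_left algebra_simps)
  ultimately show ?thesis by (simp add: power2_eq_square algebra_simps)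
qed

lemma quad_form_upd: "quad_form n A (x(n := t)) = quad_form n A x"
  by (rule quad_form_cong) auto

lemma quad_form_Suc_upd:
  assumes "pos_semidef (Suc n) A"
  shows "quad_form (Suc n) A (x(n := t))
    = quad_form n A x + 2 * t * (\<Sum>i<n. A i n * x i) + A n n * t\<^sup>2"
  using assms by (subst quad_form_Suc) (auto simp: quad_form_upd pos_semidef_def)

lemma pos_semidef_mono:
  assumes "pos_semidef n A" "k \<le> n"
  shows "pos_semidef k A"
proof -
  have "pos_semidef l A" if "pos_semidef (Suc l) A" for l
  proof (rule pos_semidefI)
    show "0 \<le> quad_form l A x" for x
      using pos_semidef_quad_form[OF that, of "x(l := 0)"] by (simp add: quad_form_Suc_upd[OF that])
  qed (use pos_semidef_sym[OF that] in auto)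
  with assms(2,1) show ?thesis by (induction rule: inc_induct) auto
qed

lemma pos_semidef_diag_nonneg:
  assumes "pos_semidef n A" "i < n"
  shows "0 \<le> A i i"
proof -
  have *: "pos_semidef (Suc i) A" using assms by (auto intro: pos_semidef_mono)
  show ?thesis
    using pos_semidef_quad_form[OF *, of "(\<lambda>_. 0)(i := 1)"]
    by (simp only: quad_form_Suc_upd[OF *]) (simp add: quad_form_def)
qed

text \<open>
  The column of the Cholesky factorization that eliminates row and column \<open>n\<close>. If the pivot
  \<open>A n n\<close> vanishes, division by zero makes it the zero vector, which is the correct choice.
\<close>
definition pivot_vec :: "nat \<Rightarrow> (nat \<Rightarrow> nat \<Rightarrow> real) \<Rightarrow> nat \<Rightarrow> real" where
  "pivot_vec n A i = A i n / sqrt (A n n)"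

text \<open>
  For a vanishing pivot this says that the whole column vanishes: otherwise the form would be
  affine and nonconstant in the last coordinate, hence somewhere negative.
\<close>
lemma pivot_vec_last_col:
  assumes A: "pos_semidef (Suc n) A" and i: "i \<le> n"
  shows "pivot_vec n A i * pivot_vec n A n = A i n"
proof -
  have nn: "0 \<le> A n n" using pos_semidef_diag_nonneg[OF A] by simp
  show ?thesis
  proof (cases "A n n = 0")
    case True
    have "A i n = 0"
    proof (cases "i = n")
      case False
      then have "i < n" using i by simp
      define q where "q = quad_form n A ((\<lambda>_. 0)(i := 1))"
      have "0 \<le> q + 2 * t * A i n" for t
      proof -
        have "(\<Sum>j<n. A j n * ((\<lambda>_. 0)(i := 1)) j) = (\<Sum>j<n. if j = i then A i n else 0)"
          by (intro sum.cong) auto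
        then have "(\<Sum>j<n. A j n * ((\<lambda>_. 0)(i := 1)) j) = A i n"
          using \<open>i < n\<close> by simp
        then show ?thesis
          using pos_semidef_quad_form[OF A, of "((\<lambda>_. 0)(i := 1))(n := t)"]
          by (simp only: quad_form_Suc_upd[OF A] True q_def)
      qed
      from this[of "- (q + 1) / (2 * A i n)"] show ?thesis
        by (cases "A i n = 0") (auto simp: field_simps)
    qed (use True in simp)
    then show ?thesis by (simp add: pivot_vec_def)
  next
    case False
    then show ?thesis using nn by (simp add: pivot_vec_def field_simps)
  qed
qed

text \<open>
  The Schur complement is the value of the form after the last coordinate has been chosen so as
  to minimize it.
\<close>
lemma pos_semidef_pivot_complement:
  assumes A: "pos_semidef (Suc n) A"
  shows "pos_semidef n (\<lambda>i j. A i j - pivot_vec n A i * pivot_vec n A j)"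
proof (rule pos_semidefI)
  fix x
  let ?z = "pivot_vec n A"
  define S where "S = (\<Sum>i<n. A i n * x i)"
  have nn: "0 \<le> A n n" using pos_semidef_diag_nonneg[OF A] by simp
  have "quad_form n (\<lambda>i j. A i j - ?z i * ?z j) x
      = quad_form n A x - (\<Sum>i<n. ?z i * x i)\<^sup>2"
    using quad_form_add[of n "\<lambda>i j. A i j - ?z i * ?z j" "\<lambda>i j. ?z i * ?z j" x]
    by (simp add: quad_form_rank_one)
  moreover have "(\<Sum>i<n. ?z i * x i) = S / sqrt (A n n)"
    by (simp add: S_def pivot_vec_def sum_divide_distrib)
  ultimately have eq: "quad_form n (\<lambda>i j. A i j - ?z i * ?z j) x = quad_form n A x - S\<^sup>2 / A n n"
    using nn by (simp add: power_divide)
  have "0 \<le> quad_form n A x + 2 * t * S + A n n * t\<^sup>2" for t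
    using pos_semidef_quad_form[OF A, of "x(n := t)"]
    by (simp only: quad_form_Suc_upd[OF A] S_def)
  \<comment> \<open>The minimizing last coordinate; for \<open>A n n = 0\<close> it is \<open>0\<close>, and \<open>S\<^sup>2 / A n n = 0\<close> as well.\<close>
  from this[of "- S / A n n"] have "0 \<le> quad_form n A x - S\<^sup>2 / A n n"
    by (cases "A n n = 0") (auto simp: power2_eq_square field_simps)
  then show "0 \<le> quad_form n (\<lambda>i j. A i j - ?z i * ?z j) x" using eq by simp
qed (use pos_semidef_sym[OF A] in auto)

text \<open>
  Splitting a multiplicative \<open>f\<close> into its rank one part and a rest that lives on the first \<open>n\<close>
  indices only. The weight \<open>C\<close> serves the Schur product theorem (with \<open>f\<close> the identity); the
  constant weight \<open>1\<close> serves the power functions.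
\<close>
lemma quad_form_pivot:
  assumes A: "pos_semidef (Suc n) A"
    and f: "\<And>x y. f (x * y) = f x * f y"
    and C: "\<And>i j. i \<le> n \<Longrightarrow> j \<le> n \<Longrightarrow> C i j = C j i"
  shows "quad_form (Suc n) (\<lambda>i j. f (A i j) * C i j) x
    = quad_form (Suc n) C (\<lambda>i. f (pivot_vec n A i) * x i)
      + quad_form n (\<lambda>i j. (f (A i j) - f (pivot_vec n A i * pivot_vec n A j)) * C i j) x"
proof -
  let ?z = "pivot_vec n A"
  let ?D = "\<lambda>i j. (f (A i j) - f (?z i * ?z j)) * C i j"
  have last: "?D i n = 0" "?D n i = 0" if "i \<le> n" for i
    using pivot_vec_last_col[OF A that] pos_semidef_sym[OF A, of i n] that
    by (simp_all add: mult.commute[of "?z n"])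
  have "quad_form (Suc n) ?D x = quad_form n ?D x"
    by (subst quad_form_Suc) (auto simp: last)
  moreover have "quad_form (Suc n) (\<lambda>i j. f (?z i * ?z j) * C i j) x
      = quad_form (Suc n) C (\<lambda>i. f (?z i) * x i)"
    by (simp add: quad_form_def f algebra_simps)
  moreover have "quad_form (Suc n) (\<lambda>i j. f (A i j) * C i j) x
     = quad_form (Suc n) (\<lambda>i j. f (?z i * ?z j) * C i j) x + quad_form (Suc n) ?D x"
    using quad_form_add[of "Suc n" "\<lambda>i j. f (?z i * ?z j) * C i j" ?D x] by (simp add: algebra_simps)
  ultimately show ?thesis by simp
qed

text \<open>
  Peeling one rank one array off \<open>A\<close> only rescales the argument of the form of \<open>B\<close>; induction
  does the rest without any spectral decomposition.
\<close>
theorem schur_product: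
  assumes "pos_semidef n A" "pos_semidef n B"
  shows "pos_semidef n (\<lambda>i j. A i j * B i j)"
  using assms
proof (induction n arbitrary: A)
  case 0
  then show ?case by (simp add: pos_semidef_def quad_form_def)
next
  case (Suc n)
  note A = Suc.prems(1) and B = Suc.prems(2)
  show ?case
  proof (rule pos_semidefI)
    fix x
    have "pos_semidef n (\<lambda>i j. (A i j - pivot_vec n A i * pivot_vec n A j) * B i j)"
      using Suc.IH[OF pos_semidef_pivot_complement[OF A]] pos_semidef_mono[OF B] by simp
    then show "0 \<le> quad_form (Suc n) (\<lambda>i j. A i j * B i j) x"
      using quad_form_pivot[OF A, of "\<lambda>x. x" B x] pos_semidef_sym[OF B] pos_semidef_quad_form[OF B]
        pos_semidef_quad_form by (auto intro!: add_nonneg_nonneg)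
  qed (use pos_semidef_sym[OF A] pos_semidef_sym[OF B] in auto)
qed

lemma pos_semidef_power:
  assumes "pos_semidef n A"
  shows "pos_semidef n (\<lambda>i j. A i j ^ k)"
proof (induction k)
  case 0
  show ?case using pos_semidef_rank_one[of n "\<lambda>_. 1"] by simp
next
  case (Suc k)
  then show ?case using schur_product[OF assms Suc] by simp
qed

text \<open>
  For a multiplicative function it suffices to compare \<open>A\<close> with its rank one part on the first \<open>n\<close>
  indices, because the two agree in the last row and column.
\<close>
lemma pos_semidef_multiplicative_Suc:
  assumes A: "pos_semidef (Suc n) A"
    and f: "\<And>x y. f (x * y) = f x * f y"
    and rest: "\<And>x. quad_form n (\<lambda>i j. f (pivot_vec n A i * pivot_vec n A j)) x
                 \<le> quad_form n (\<lambda>i j. f (A i j)) x"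
  shows "pos_semidef (Suc n) (\<lambda>i j. f (A i j))"
proof (rule pos_semidefI)
  fix x
  let ?z = "pivot_vec n A"
  have "quad_form n (\<lambda>i j. f (A i j)) x = quad_form n (\<lambda>i j. f (?z i * ?z j)) x
      + quad_form n (\<lambda>i j. f (A i j) - f (?z i * ?z j)) x"
    by (subst quad_form_add[symmetric]) simp
  then have "0 \<le> quad_form n (\<lambda>i j. f (A i j) - f (?z i * ?z j)) x" using rest[of x] by simp
  then show "0 \<le> quad_form (Suc n) (\<lambda>i j. f (A i j)) x"
    using quad_form_pivot[OF A f, of "\<lambda>_ _. 1" x] quad_form_rank_one[of "Suc n" "\<lambda>_. 1"]
    by simp
qed (use pos_semidef_sym[OF A] in auto)

section \<open>The even and the odd power function\<close>

lemma phi_mult: "phi \<alpha> (x * y) = phi \<alpha> x * phi \<alpha> y"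
  by (simp add: phi_def abs_mult powr_mult)

lemma psi_mult: "psi \<alpha> (x * y) = psi \<alpha> x * psi \<alpha> y"
  by (simp add: psi_def abs_mult powr_mult sgn_mult)

lemma phi_at_0: "0 < \<beta> \<Longrightarrow> (phi \<beta> \<longlongrightarrow> 0) (at 0)"
proof -
  assume "0 < \<beta>"
  have "((\<lambda>y::real. \<bar>y\<bar> powr \<beta>) \<longlongrightarrow> 0) (at 0)"
    by (rule tendsto_zero_powrI[OF _ tendsto_const _ \<open>0 < \<beta>\<close>]) (auto intro!: tendsto_eq_intros)
  moreover have "phi \<beta> = (\<lambda>y. \<bar>y\<bar> powr \<beta>)" by (auto simp: phi_def)
  ultimately show ?thesis by simp
qed

lemma abs_psi: "\<bar>psi \<alpha> x\<bar> = phi \<alpha> x"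
  by (simp add: psi_def phi_def abs_mult)

lemma phi_mono: "0 < \<alpha> \<Longrightarrow> 0 \<le> x \<Longrightarrow> x \<le> y \<Longrightarrow> phi \<alpha> x \<le> phi \<alpha> y"
  by (auto simp: phi_def powr_mono2)

lemma psi_eq_phi: "0 \<le> x \<Longrightarrow> psi \<alpha> x = phi \<alpha> x"
  by (simp add: psi_def phi_def)

lemma psi_mono: "0 < \<alpha> \<Longrightarrow> 0 \<le> x \<Longrightarrow> x \<le> y \<Longrightarrow> psi \<alpha> x \<le> psi \<alpha> y"
  using phi_mono[of \<alpha> x y] by (simp add: psi_eq_phi)

lemma psi_eq_phi_divide:
  assumes "y \<noteq> 0"
  shows "psi (\<alpha> - 1) y = phi \<alpha> y / y"
  using assms by (cases "0 < y") (simp_all add: psi_def phi_def powr_diff)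

lemma phi_eq_psi_divide:
  assumes "y \<noteq> 0"
  shows "phi (\<alpha> - 1) y = psi \<alpha> y / y"
  using assms by (cases "0 < y") (simp_all add: psi_def phi_def powr_diff)

text \<open>
  Differentiation exchanges the even and the odd power function. This is why the induction on
  the size has to treat both functions together.
\<close>
lemma phi_deriv:
  assumes "1 < \<alpha>"
  shows "(phi \<alpha> has_real_derivative \<alpha> * psi (\<alpha> - 1) x) (at x)"
proof -
  consider "x = 0" | "0 < x" | "x < 0" by linarith
  then show ?thesis
  proof cases
    case 1
    have "((\<lambda>y. \<bar>psi (\<alpha> - 1) y\<bar>) \<longlongrightarrow> 0) (at 0)"
      using phi_at_0[of "\<alpha> - 1"] assms by (simp add: abs_psi)
    then have "(psi (\<alpha> - 1) \<longlongrightarrow> 0) (at 0)" by (rule tendsto_rabs_zero_cancel)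
    moreover have "\<forall>\<^sub>F y in at 0. psi (\<alpha> - 1) y = (phi \<alpha> y - phi \<alpha> 0) / (y - 0)"
      by (simp add: eventually_at_filter psi_eq_phi_divide phi_def[of _ 0])
    ultimately have "((\<lambda>y. (phi \<alpha> y - phi \<alpha> 0) / (y - 0)) \<longlongrightarrow> 0) (at 0)"
      by (rule Lim_transform_eventually)
    then show ?thesis using 1 by (simp add: has_field_derivative_iff psi_def)
  next
    case 2
    have "\<forall>\<^sub>F y in nhds x. phi \<alpha> y = y powr \<alpha>"
      using eventually_nhds_in_open[OF open_greaterThan, of x 0] 2
      by (auto elim!: eventually_mono simp: phi_def)
    then show ?thesis using 2
      by (subst DERIV_cong_ev[OF refl _ refl])
        (auto intro!: derivative_eq_intros simp: psi_def)
  next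
    case 3
    have "\<forall>\<^sub>F y in nhds x. phi \<alpha> y = (- y) powr \<alpha>"
      using eventually_nhds_in_open[OF open_lessThan, of x 0] 3
      by (auto elim!: eventually_mono simp: phi_def)
    then show ?thesis using 3
      by (subst DERIV_cong_ev[OF refl _ refl])
        (auto intro!: derivative_eq_intros simp: psi_def)
  qed
qed

lemma psi_deriv:
  assumes "1 < \<alpha>"
  shows "(psi \<alpha> has_real_derivative \<alpha> * phi (\<alpha> - 1) x) (at x)"
proof -
  consider "x = 0" | "0 < x" | "x < 0" by linarith
  then show ?thesis
  proof cases
    case 1
    have "(phi (\<alpha> - 1) \<longlongrightarrow> 0) (at 0)"
      using phi_at_0[of "\<alpha> - 1"] assms by simp
    moreover have "\<forall>\<^sub>F y in at 0. phi (\<alpha> - 1) y = (psi \<alpha> y - psi \<alpha> 0) / (y - 0)"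
      by (simp add: eventually_at_filter phi_eq_psi_divide psi_def[of _ 0])
    ultimately have "((\<lambda>y. (psi \<alpha> y - psi \<alpha> 0) / (y - 0)) \<longlongrightarrow> 0) (at 0)"
      by (rule Lim_transform_eventually)
    then show ?thesis using 1 by (simp add: has_field_derivative_iff phi_def)
  next
    case 2
    have "\<forall>\<^sub>F y in nhds x. psi \<alpha> y = y powr \<alpha>"
      using eventually_nhds_in_open[OF open_greaterThan, of x 0] 2
      by (auto elim!: eventually_mono simp: psi_def)
    then show ?thesis using 2
      by (subst DERIV_cong_ev[OF refl _ refl])
        (auto intro!: derivative_eq_intros simp: phi_def)
  next
    case 3
    have "\<forall>\<^sub>F y in nhds x. psi \<alpha> y = - ((- y) powr \<alpha>)"
      using eventually_nhds_in_open[OF open_lessThan, of x 0] 3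
      by (auto elim!: eventually_mono simp: psi_def)
    then show ?thesis using 3
      by (subst DERIV_cong_ev[OF refl _ refl])
        (auto intro!: derivative_eq_intros simp: phi_def)
  qed
qed

lemma psi_eq_sgn_phi: "psi \<alpha> t = sgn t * phi \<alpha> t"
  by (simp add: psi_def phi_def)

lemma phi_nat: "0 < k \<Longrightarrow> phi (real k) t = \<bar>t\<bar> ^ k"
  by (simp add: phi_def powr_realpow)

lemma psi_nat_odd: "odd k \<Longrightarrow> psi (real k) t = t ^ k"
  by (cases "0 \<le> t") (auto simp: psi_eq_sgn_phi phi_nat odd_pos sgn_if power_minus_odd)

lemma psi_nat_even: "even k \<Longrightarrow> 0 < k \<Longrightarrow> psi (real k) t = sgn t * t ^ k"
  by (simp add: psi_eq_sgn_phi phi_nat power_even_abs)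

lemma phi_nat_odd: "odd k \<Longrightarrow> phi (real k) t = sgn t * t ^ k"
  by (cases "0 \<le> t") (auto simp: phi_nat odd_pos sgn_if power_minus_odd)

section \<open>Entrywise powers that preserve positive semidefiniteness\<close>

text \<open>
  The derivative of the form of \<open>f\<close> along the segment from \<open>A\<close> to \<open>B\<close> belongs to the Schur
  product of \<open>B - A\<close> with the array of the values of \<open>f'\<close>.
\<close>
lemma quad_form_increasing_along_segment:
  fixes f f' :: "real \<Rightarrow> real"
  assumes f': "\<And>x. (f has_real_derivative f' x) (at x)"
    and D: "pos_semidef n (\<lambda>i j. B i j - A i j)"
    and seg: "\<And>t. 0 \<le> t \<Longrightarrow> t \<le> 1 \<Longrightarrow> pos_semidef n (\<lambda>i j. f' (A i j + t * (B i j - A i j)))"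
  shows "quad_form n (\<lambda>i j. f (A i j)) x \<le> quad_form n (\<lambda>i j. f (B i j)) x"
proof -
  let ?p = "\<lambda>t i j. A i j + t * (B i j - A i j)"
  let ?g = "\<lambda>t. quad_form n (\<lambda>i j. f (?p t i j)) x"
  have "?g 0 \<le> ?g 1"
  proof (rule DERIV_nonneg_imp_nondecreasing[where f = ?g])
    fix t :: real assume t: "0 \<le> t" "t \<le> 1"
    have "(?g has_real_derivative quad_form n (\<lambda>i j. (B i j - A i j) * f' (?p t i j)) x) (at t)"
      unfolding quad_form_def
      by (auto intro!: DERIV_sum derivative_eq_intros DERIV_chain2[OF f'] simp: algebra_simps)
    moreover have "0 \<le> quad_form n (\<lambda>i j. (B i j - A i j) * f' (?p t i j)) x"
      by (intro pos_semidef_quad_form schur_product D seg t)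
    ultimately show "\<exists>y. (?g has_real_derivative y) (at t) \<and> 0 \<le> y" by blast
  qed simp
  then show ?thesis by simp
qed

lemma quad_form_1_mono: "A 0 0 \<le> B 0 0 \<Longrightarrow> quad_form 1 A x \<le> quad_form 1 B x"
proof -
  have "quad_form 1 C x = C 0 0 * (x 0)\<^sup>2" for C
    by (simp add: quad_form_def power2_eq_square)
  then show "A 0 0 \<le> B 0 0 \<Longrightarrow> ?thesis" by (simp add: mult_right_mono)
qed

text \<open>
  For \<open>n > 2\<close> the strict bound gives \<open>\<alpha> > 1\<close>, so that both functions are differentiable everywhere,
  also at \<open>0\<close>. For \<open>n = 2\<close> monotonicity on the nonnegative numbers replaces the derivative.
\<close>
lemma pos_semidef_powers_strict:
  assumes "real n - 2 < \<alpha>" "2 \<le> n" "pos_semidef n A"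
  shows "pos_semidef n (\<lambda>i j. phi \<alpha> (A i j)) \<and> pos_semidef n (\<lambda>i j. psi \<alpha> (A i j))"
  using assms(2,1,3)
proof (induction n arbitrary: \<alpha> A rule: dec_induct)
  case base
  then have A: "pos_semidef (Suc 1) A" and "0 < \<alpha>" by (simp_all add: numeral_2_eq_2)
  have "0 \<le> (pivot_vec 1 A 0)\<^sup>2" "(pivot_vec 1 A 0)\<^sup>2 \<le> A 0 0"
    using pos_semidef_diag_nonneg[OF pos_semidef_pivot_complement[OF A], of 0]
    by (simp_all add: power2_eq_square)
  then have "phi \<alpha> ((pivot_vec 1 A 0)\<^sup>2) \<le> phi \<alpha> (A 0 0)" "psi \<alpha> ((pivot_vec 1 A 0)\<^sup>2) \<le> psi \<alpha> (A 0 0)"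
    using \<open>0 < \<alpha>\<close> by (auto intro: phi_mono psi_mono)
  then have "quad_form 1 (\<lambda>i j. phi \<alpha> (pivot_vec 1 A i * pivot_vec 1 A j)) x
      \<le> quad_form 1 (\<lambda>i j. phi \<alpha> (A i j)) x"
    and "quad_form 1 (\<lambda>i j. psi \<alpha> (pivot_vec 1 A i * pivot_vec 1 A j)) x
      \<le> quad_form 1 (\<lambda>i j. psi \<alpha> (A i j)) x" for x
    unfolding power2_eq_square by (blast intro: quad_form_1_mono)+
  then show ?case
    using pos_semidef_multiplicative_Suc[OF A, where f = "phi \<alpha>", OF phi_mult]
      pos_semidef_multiplicative_Suc[OF A, where f = "psi \<alpha>", OF psi_mult]
    by (simp add: numeral_2_eq_2)
next
  case (step n)
  note A = step.prems(2)
  let ?z = "pivot_vec n A"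
  have \<alpha>: "1 < \<alpha>" "real n - 2 < \<alpha> - 1" using step by auto
  have D: "pos_semidef n (\<lambda>i j. A i j - ?z i * ?z j)"
    by (rule pos_semidef_pivot_complement[OF A])
  have seg: "pos_semidef n (\<lambda>i j. ?z i * ?z j + t * (A i j - ?z i * ?z j))" if "0 \<le> t" for t
    by (intro pos_semidef_add pos_semidef_rank_one pos_semidef_cmult that D)
  have "pos_semidef n (\<lambda>i j. \<alpha> * psi (\<alpha> - 1) (?z i * ?z j + t * (A i j - ?z i * ?z j)))"
    "pos_semidef n (\<lambda>i j. \<alpha> * phi (\<alpha> - 1) (?z i * ?z j + t * (A i j - ?z i * ?z j)))"
    if "0 \<le> t" for t
    using step.IH[OF \<alpha>(2) seg[OF that]] \<alpha>(1) by (auto intro!: pos_semidef_cmult)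
  then show ?case
    using quad_form_increasing_along_segment[OF phi_deriv[OF \<alpha>(1)] D]
      quad_form_increasing_along_segment[OF psi_deriv[OF \<alpha>(1)] D]
    by (auto intro!: pos_semidef_multiplicative_Suc[OF A] phi_mult psi_mult)
qed

lemma pos_semidef_limit:
  assumes "\<And>k. pos_semidef n (A k)" "\<And>i j. (\<lambda>k. A k i j) \<longlonglongrightarrow> B i j"
  shows "pos_semidef n B"
proof (rule pos_semidefI)
  fix i j assume "i < n" "j < n"
  then have "(\<lambda>k. A k i j) = (\<lambda>k. A k j i)" using assms(1) pos_semidef_sym by blast
  then show "B i j = B j i" using assms(2)[of i j] assms(2)[of j i] LIMSEQ_unique by metis
next
  fix x
  have "(\<lambda>k. quad_form n (A k) x) \<longlonglongrightarrow> quad_form n B x"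
    unfolding quad_form_def by (intro tendsto_intros assms)
  then show "0 \<le> quad_form n B x"
    by (rule LIMSEQ_le_const) (auto intro: pos_semidef_quad_form assms)
qed

text \<open>
  The boundary exponent \<open>n - 2\<close> is a limit of larger ones. Both functions vanish at \<open>0\<close> for every
  exponent, so they converge pointwise there too.
\<close>
lemma pos_semidef_powers:
  assumes "real n - 2 \<le> \<alpha>" "2 \<le> n" "pos_semidef n A"
  shows "pos_semidef n (\<lambda>i j. phi \<alpha> (A i j))" "pos_semidef n (\<lambda>i j. psi \<alpha> (A i j))"
proof -
  define a where "a k = \<alpha> + inverse (real (Suc k))" for k
  have "(\<lambda>k. inverse (real (Suc k))) \<longlonglongrightarrow> 0" by (rule LIMSEQ_inverse_real_of_nat)
  then have lim: "a \<longlonglongrightarrow> \<alpha>" unfolding a_def using tendsto_add[OF tendsto_const] by force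
  have "real n - 2 < a k" for k using assms(1)
    by (simp add: a_def) (smt (verit) inverse_positive_iff_positive of_nat_0_le_iff)
  note P = pos_semidef_powers_strict[OF this assms(2,3)]
  have "(\<lambda>k. phi (a k) y) \<longlonglongrightarrow> phi \<alpha> y" "(\<lambda>k. psi (a k) y) \<longlonglongrightarrow> psi \<alpha> y" for y
    unfolding phi_def psi_def by (auto intro!: tendsto_intros lim)
  with P show "pos_semidef n (\<lambda>i j. phi \<alpha> (A i j))" "pos_semidef n (\<lambda>i j. psi \<alpha> (A i j))"
    by (auto intro: pos_semidef_limit[where A = "\<lambda>k i j. phi (a k) (A i j)"]
          pos_semidef_limit[where A = "\<lambda>k i j. psi (a k) (A i j)"])
qed

section \<open>Entrywise powers that destroy positive semidefiniteness\<close>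

text \<open>
  The weights are the values at \<open>y\<close> of the Lagrange basis polynomials. Moving \<open>y\<close> to the other side
  gives a functional on \<open>k + 1\<close> points that annihilates all polynomials of degree less than \<open>k\<close>.
\<close>
lemma lagrange_weights:
  fixes x :: "nat \<Rightarrow> real" and y :: real
  assumes "inj_on x {..<k}"
  shows "\<exists>c. \<forall>p. degree p < k \<longrightarrow> poly p y = (\<Sum>i<k. c i * poly p (x i))"
proof -
  define L where "L i = (\<Prod>j\<in>{..<k} - {i}. smult (1 / (x i - x j)) [:- x j, 1:])" for i
  have poly_L: "poly (L i) z = (\<Prod>j\<in>{..<k} - {i}. (z - x j) / (x i - x j))" for i z
    by (simp add: L_def poly_prod diff_divide_distrib)
  have L_node: "poly (L i) (x l) = (if l = i then 1 else 0)" if "i < k" "l < k" for i l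
  proof (cases "l = i")
    case True
    have "x i - x j \<noteq> 0" if "j \<in> {..<k} - {i}" for j
      using assms that \<open>i < k\<close> by (auto dest: inj_onD)
    then show ?thesis using True by (simp add: poly_L)
  next
    case False
    then show ?thesis using that unfolding poly_L by (auto intro!: prod_zero)
  qed
  have deg_L: "degree (L i) < k" if "i < k" for i
  proof -
    have "degree (L i) \<le> (\<Sum>j\<in>{..<k} - {i}. degree (smult (1 / (x i - x j)) [:- x j, 1:]))"
      using degree_prod_sum_le[of "{..<k} - {i}" "\<lambda>j. smult (1 / (x i - x j)) [:- x j, 1:]"]
      unfolding L_def comp_def by blast
    also have "\<dots> \<le> (\<Sum>j\<in>{..<k} - {i}. 1)"
      by (intro sum_mono order_trans[OF degree_smult_le]) simp
    also have "\<dots> < k" using that by simp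
    finally show ?thesis .
  qed
  have "poly p y = (\<Sum>i<k. poly (L i) y * poly p (x i))" if "degree p < k" for p
  proof -
    define q where "q = (\<Sum>i<k. smult (poly p (x i)) (L i))"
    have "p = q"
    proof (rule poly_eqI_degree[where A = "x ` {..<k}"])
      fix z assume "z \<in> x ` {..<k}"
      then obtain l where l: "l < k" "z = x l" by auto
      have "poly q z = (\<Sum>i<k. if i = l then poly p (x i) else 0)"
        unfolding q_def poly_sum using l L_node by (intro sum.cong) auto
      then show "poly p z = poly q z" using l by simp
    next
      have "degree q \<le> k - 1"
        unfolding q_def
      proof (rule degree_sum_le)
        fix i assume "i \<in> {..<k}"
        then show "degree (smult (poly p (x i)) (L i)) \<le> k - 1"
          using deg_L[of i] degree_smult_le[of "poly p (x i)" "L i"] by simp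
      qed simp
      then show "degree q < card (x ` {..<k})" using that assms by (simp add: card_image)
    qed (use that assms in \<open>simp add: card_image\<close>)
    then have "poly p y = poly q y" by simp
    then show ?thesis by (simp add: q_def poly_sum mult.commute)
  qed
  then show ?thesis by (intro exI[of _ "\<lambda>i. poly (L i) y"]) simp
qed

lemma pos_semidef_const_add_rank_one:
  assumes "0 \<le> h"
  shows "pos_semidef n (\<lambda>i j. 1 + h * (x i * x j))"
  using pos_semidef_add[OF pos_semidef_rank_one[of n "\<lambda>_. 1"]
      pos_semidef_cmult[OF assms pos_semidef_rank_one[of n x]]] by simp

text \<open>A decreasing function makes the diagonal smaller than the other entries.\<close>
lemma negative_power_not_pos_semidef:
  assumes "\<alpha> < 0" and f: "f 1 = 1" "f 2 = 2 powr \<alpha>"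
  defines "A \<equiv> \<lambda>i j. if i = j then 2 else 1 :: real"
  shows "pos_semidef n A" "\<not> pos_semidef 2 (\<lambda>i j. f (A i j))"
proof -
  have "quad_form n (\<lambda>i j. if i = j then 1 else 0) x = (\<Sum>i<n. (x i)\<^sup>2)" for x
  proof -
    have "quad_form n (\<lambda>i j. if i = j then 1 else 0) x = (\<Sum>i<n. \<Sum>j<n. if i = j then x i * x j else 0)"
      unfolding quad_form_def by (intro sum.cong) auto
    then show ?thesis by (simp add: power2_eq_square)
  qed
  then have "pos_semidef n (\<lambda>i j. if i = j then 1 else 0)"
    by (intro pos_semidefI) (auto intro: sum_nonneg)
  from pos_semidef_add[OF pos_semidef_rank_one[of n "\<lambda>_. 1"] this]
  show "pos_semidef n A"
    by (rule pos_semidef_cong[THEN iffD1, rotated]) (simp add: A_def)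
  have "(2::real) powr \<alpha> < 1" using powr_less_mono[OF assms(1), of 2] by simp
  then have "quad_form 2 (\<lambda>i j. f (A i j)) (\<lambda>i. if i = 0 then 1 else -1) < 0"
    by (simp add: quad_form_def A_def f lessThan_nat_numeral)
  then show "\<not> pos_semidef 2 (\<lambda>i j. f (A i j))"
    using pos_semidef_quad_form not_le by blast
qed

text \<open>
  On \<open>k + 1\<close> nodes, the functional with the Lagrange weights kills degrees less than \<open>k\<close> but not
  degree \<open>k\<close>, since it does not kill the polynomial whose roots are the first \<open>k\<close> nodes.
\<close>
lemma moment_weights:
  fixes x :: "nat \<Rightarrow> real"
  assumes "inj_on x {..k}"
  obtains v where "\<And>l. l < k \<Longrightarrow> (\<Sum>i\<le>k. v i * x i ^ l) = 0" "(\<Sum>i\<le>k. v i * x i ^ k) \<noteq> 0"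
proof -
  have "inj_on x {..<k}" using assms by (auto intro: inj_on_subset)
  from lagrange_weights[OF this, of "x k"] obtain c
    where c: "\<And>p. degree p < k \<Longrightarrow> poly p (x k) = (\<Sum>i<k. c i * poly p (x i))" by blast
  define v where "v i = (if i = k then 1 else - c i)" for i
  have ann: "(\<Sum>i\<le>k. v i * poly p (x i)) = 0" if "degree p < k" for p
  proof -
    have "(\<Sum>i<k. v i * poly p (x i)) = - (\<Sum>i<k. c i * poly p (x i))"
      unfolding sum_negf[symmetric] by (intro sum.cong) (auto simp: v_def)
    then show ?thesis using c[OF that] by (simp add: lessThan_Suc_atMost[symmetric] v_def)
  qed
  show ?thesis
  proof
    show "(\<Sum>i\<le>k. v i * x i ^ l) = 0" if "l < k" for l
      using ann[of "monom 1 l"] that by (simp add: degree_monom_eq poly_monom)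
    \<comment> \<open>Modulo lower degrees, \<open>X\<^sup>k\<close> equals the nodal polynomial, whose weighted sum has one term.\<close>
    define P where "P = (\<Prod>j<k. [:- x j, 1:])"
    have deg: "degree P = k"
      unfolding P_def by (simp add: degree_prod_eq_sum_degree)
    have lead: "lead_coeff P = 1"
      unfolding P_def lead_coeff_prod by simp
    show "(\<Sum>i\<le>k. v i * x i ^ k) \<noteq> 0"
    proof (cases "k = 0")
      case False
      have "degree (monom 1 k - P) < k"
        using deg lead False
        by (intro degree_lessI) (auto simp: coeff_eq_0)
      from ann[OF this] have "(\<Sum>i\<le>k. v i * x i ^ k) = (\<Sum>i\<le>k. v i * poly P (x i))"
        by (simp add: poly_monom algebra_simps sum_subtractf)
      also have "\<dots> = poly P (x k)"
      proof -
        have "(\<Sum>i<k. v i * poly P (x i)) = 0"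
          unfolding P_def poly_prod by (intro sum.neutral) (auto intro!: prod_zero)
        then show ?thesis by (simp add: lessThan_Suc_atMost[symmetric] v_def)
      qed
      also have "\<dots> \<noteq> 0"
        unfolding P_def poly_prod by (auto simp: inj_on_eq_iff[OF assms])
      finally show ?thesis .
    qed (simp add: v_def)
  qed
qed

text \<open>All factors are positive except the last one, \<open>\<alpha> - (p + 1)\<close>.\<close>
lemma falling_factorial_neg:
  assumes "real p < \<alpha>" "\<alpha> < real p + 1"
  shows "(\<Prod>r<Suc (Suc p). \<alpha> - real r) < 0"
proof -
  have "0 < (\<Prod>r<Suc p. \<alpha> - real r)" using assms by (intro prod_pos) auto
  then show ?thesis using assms
    by (subst prod.lessThan_Suc) (auto intro!: mult_pos_neg)
qed

text \<open>
  With \<open>k = \<lfloor>\<alpha>\<rfloor> + 2\<close>, the form of \<open>(1 + t x\<^sub>i x\<^sub>j) powr \<alpha>\<close> at \<open>v\<close> has the Taylor coefficients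
  \<open>(\<alpha> gchoose l) (\<Sum>\<^sub>i v\<^sub>i x\<^sub>i\<^sup>l)\<^sup>2\<close> at \<open>t = 0\<close>. They vanish for \<open>l < k\<close> by the choice of \<open>v\<close>, and the
  one with \<open>l = k\<close> is negative. The \<open>k + 1 = p + 3\<close> nodes fit into \<open>n\<close> rows iff \<open>\<alpha> < n - 2\<close>.
\<close>
lemma nonint_power_not_pos_semidef:
  assumes p: "real p < \<alpha>" "\<alpha> < real p + 1"
    and f: "\<And>t. 0 < t \<Longrightarrow> f t = t powr \<alpha>"
  shows "\<exists>A. (\<forall>n. pos_semidef n A) \<and> \<not> pos_semidef (p + 3) (\<lambda>i j. f (A i j))"
proof -
  define k where "k = Suc (Suc p)"
  define x where "x i = real (Suc i)" for i
  have xpos: "0 < x i" for i by (simp add: x_def)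
  have "inj_on x {..k}" by (auto simp: x_def inj_on_def)
  then obtain v where v0: "\<And>l. l < k \<Longrightarrow> (\<Sum>i\<le>k. v i * x i ^ l) = 0"
    and vk: "(\<Sum>i\<le>k. v i * x i ^ k) \<noteq> 0" by (rule moment_weights) blast
  define ff where "ff l = (\<Prod>r<l. \<alpha> - real r)" for l
  \<comment> \<open>\<open>g l\<close> is the \<open>l\<close>-th derivative of the form \<open>g 0\<close> with respect to \<open>t\<close>.\<close>
  define g where "g l t = (\<Sum>i\<le>k. \<Sum>j\<le>k. v i * v j * (x i * x j) ^ l * ff l
       * (1 + t * (x i * x j)) powr (\<alpha> - real l))" for l t
  have pos: "0 < 1 + t * (x i * x j)" if "0 \<le> t" for t i j
    using that xpos[of i] xpos[of j] by (simp add: add_pos_nonneg)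
  have deriv: "DERIV (g l) t :> g (Suc l) t" if "0 \<le> t" for l t
    unfolding g_def using pos[OF that]
    by (auto intro!: DERIV_sum derivative_eq_intros simp: ff_def algebra_simps)
  have g0: "g l 0 = ff l * (\<Sum>i\<le>k. v i * x i ^ l)\<^sup>2" for l
    by (simp add: g_def power2_eq_square sum_product sum_distrib_left power_mult_distrib algebra_simps)
  have "ff k < 0" unfolding ff_def k_def using p by (rule falling_factorial_neg)
  then have neg0: "g k 0 < 0" using vk by (simp add: g0 mult_neg_pos)
  have "isCont (g k) 0" using deriv[of 0 k] DERIV_isCont by blast
  then have "\<forall>\<^sub>F t in at 0. g k t < 0"
    using neg0 by (intro order_tendstoD(2)[where a = 0]) (auto simp: isCont_def)
  then obtain h where h: "0 < h" "\<And>t. t \<noteq> 0 \<Longrightarrow> \<bar>t\<bar> < h \<Longrightarrow> g k t < 0"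
    by (auto simp: eventually_at dist_real_def)
  have "\<exists>t>0. t < h / 2 \<and> g 0 (h / 2) = (\<Sum>m<k. g m 0 / fact m * (h / 2) ^ m) + g k t / fact k * (h / 2) ^ k"
    by (rule Maclaurin) (use h deriv in \<open>auto simp: k_def\<close>)
  then obtain t where t: "0 < t" "t < h / 2"
    "g 0 (h / 2) = (\<Sum>m<k. g m 0 / fact m * (h / 2) ^ m) + g k t / fact k * (h / 2) ^ k" by blast
  have "(\<Sum>m<k. g m 0 / fact m * (h / 2) ^ m) = 0"
    by (intro sum.neutral) (auto simp: g0 v0)
  moreover have "g k t / fact k * (h / 2) ^ k < 0"
    using h(2)[of t] t h(1) by (intro mult_neg_pos) (auto intro: divide_neg_pos)
  ultimately have neg: "g 0 (h / 2) < 0" using t by simp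
  define A where "A i j = 1 + h / 2 * (x i * x j)" for i j
  have "quad_form (p + 3) (\<lambda>i j. f (A i j)) v = g 0 (h / 2)"
  proof -
    have "{..<p + 3} = {..k}" by (auto simp: k_def)
    moreover have "f (A i j) = (1 + h / 2 * (x i * x j)) powr \<alpha>" for i j
      using pos[of "h / 2" i j] h(1) by (simp add: A_def f)
    ultimately show ?thesis by (simp add: quad_form_def g_def ff_def mult_ac)
  qed
  then have "\<not> pos_semidef (p + 3) (\<lambda>i j. f (A i j))"
    using neg pos_semidef_quad_form[of "p + 3" "\<lambda>i j. f (A i j)" v] by auto
  moreover have "pos_semidef n A" for n
    unfolding A_def using h(1) by (intro pos_semidef_const_add_rank_one) simp
  ultimately show ?thesis by (intro exI[of _ A]) simp
qed

text \<open>
  The nodes are \<open>2\<close>, \<open>-2\<close> and \<open>k + 1\<close> numbers between \<open>0\<close> and \<open>1/2\<close>, so \<open>1 + x\<^sub>i x\<^sub>j\<close> is negative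
  only for the pair \<open>2, -2\<close>. Replacing \<open>sgn t * t ^ k\<close> by \<open>t ^ k\<close> changes the form only at this pair,
  and the form of the polynomial \<open>(1 + x\<^sub>i x\<^sub>j) ^ k\<close> is zero at any \<open>v\<close> that annihilates degree at
  most \<open>k\<close>. Since the small nodes can absorb arbitrary weights at \<open>2\<close> and \<open>-2\<close>, the sign of the
  product of these two weights is free.
\<close>
lemma sgn_power_not_pos_semidef:
  assumes f: "\<And>t. f t = sgn t * t ^ k"
  shows "\<exists>A. (\<forall>n. pos_semidef n A) \<and> \<not> pos_semidef (k + 3) (\<lambda>i j. f (A i j))"
proof -
  define x :: "nat \<Rightarrow> real" where
    "x i = (if i \<le> k then 1 / real (i + 3) else if i = Suc k then 2 else - 2)" for i
  have inj: "inj_on x {..<Suc k}" by (auto simp: x_def inj_on_def)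
  obtain c where c: "\<And>p. degree p < Suc k \<Longrightarrow> poly p 2 = (\<Sum>i<Suc k. c i * poly p (x i))"
    using lagrange_weights[OF inj, of 2] by blast
  obtain d where d: "\<And>p. degree p < Suc k \<Longrightarrow> poly p (- 2) = (\<Sum>i<Suc k. d i * poly p (x i))"
    using lagrange_weights[OF inj, of "- 2"] by blast
  \<comment> \<open>The entry at the pair \<open>2, -2\<close> is \<open>-3\<close>; the sign \<open>s\<close> turns \<open>(-3) ^ k\<close> into \<open>3 ^ k\<close>.\<close>
  define s where "s = (- 1 :: real) ^ k"
  define v where "v i = (if i \<le> k then - c i - s * d i else if i = Suc k then 1 else s)" for i
  have split: "(\<Sum>i<k+3. F i) = (\<Sum>i<Suc k. F i) + F (Suc k) + F (Suc (Suc k))" for F :: "nat \<Rightarrow> real"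
    by (simp add: numeral_3_eq_3)
  have ann: "(\<Sum>i<k+3. v i * poly p (x i)) = 0" if "degree p \<le> k" for p
  proof -
    have "(\<Sum>i<Suc k. v i * poly p (x i)) = (\<Sum>i<Suc k. - (c i * poly p (x i)) - s * (d i * poly p (x i)))"
      by (intro sum.cong) (auto simp: v_def algebra_simps)
    also have "\<dots> = - poly p 2 - s * poly p (- 2)"
      using c[of p] d[of p] that by (simp only: sum_subtractf sum_negf sum_distrib_left[symmetric] le_imp_less_Suc)
    finally show ?thesis by (simp add: split) (simp add: v_def x_def)
  qed
  define A where "A i j = 1 + 1 * (x i * x j)" for i j
  let ?bad = "\<lambda>i j. (i = Suc k \<and> j = Suc (Suc k)) \<or> (i = Suc (Suc k) \<and> j = Suc k)"
  have x_small: "0 < x i" "x i < 1 / 2" if "i \<le> k" for i using that by (auto simp: x_def field_simps)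
  have fA: "f (A i j) = A i j ^ k - (if ?bad i j then 2 * (- 3) ^ k else 0)" if "i < k + 3" "j < k + 3" for i j
  proof (cases "?bad i j")
    case True
    then have "A i j = - 3" by (auto simp: A_def x_def)
    then show ?thesis using True by (simp add: f)
  next
    case False
    have "0 < A i j"
    proof -
      have "i \<le> k \<or> i = Suc k \<or> i = Suc (Suc k)" "j \<le> k \<or> j = Suc k \<or> j = Suc (Suc k)"
        using that by arith+
      then consider "i \<le> k" "j \<le> k" | "i \<le> k" "j = Suc k" | "i \<le> k" "j = Suc (Suc k)"
        | "j \<le> k" "i = Suc k" | "j \<le> k" "i = Suc (Suc k)" | "i = Suc k" "j = Suc k"
        | "i = Suc (Suc k)" "j = Suc (Suc k)"
        using False by blast
      then show ?thesis
      proof cases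
        case 1
        then show ?thesis using x_small[of i] x_small[of j] by (simp add: A_def add_pos_pos)
      qed (use x_small[of i] x_small[of j] in \<open>auto simp: A_def x_def[of "Suc k"] x_def[of "Suc (Suc k)"] add_pos_nonneg\<close>)
    qed
    then show ?thesis using False by (simp add: f)
  qed
  have poly0: "quad_form (k + 3) (\<lambda>i j. A i j ^ k) v = 0"
  proof -
    have "(\<Sum>j<k+3. A i j ^ k * v i * v j) = 0" for i
    proof -
      have "(\<Sum>j<k+3. v j * poly ([:1, x i:] ^ k) (x j)) = 0"
        by (rule ann) (rule order_trans[OF degree_power_le], simp)
      then have "v i * (\<Sum>j<k+3. v j * (1 + x i * x j) ^ k) = 0" by (simp add: poly_power mult_ac)
      then show ?thesis by (simp only: sum_distrib_left A_def mult_1) (simp add: mult_ac)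
    qed
    then show ?thesis by (simp add: quad_form_def)
  qed
  have bad: "quad_form (k + 3) (\<lambda>i j. if ?bad i j then 2 * (- 3) ^ k else 0) v = 2 * (2 * (- 3) ^ k) * s"
  proof -
    have "(\<Sum>i<Suc k. \<Sum>j<k+3. (if ?bad i j then 2 * (- 3) ^ k else 0) * v i * v j) = 0"
      by (intro sum.neutral ballI) auto
    moreover have "(\<Sum>j<k+3. (if ?bad (Suc k) j then 2 * (- 3) ^ k else 0) * v (Suc k) * v j) = 2 * (- 3) ^ k * s"
      "(\<Sum>j<k+3. (if ?bad (Suc (Suc k)) j then 2 * (- 3) ^ k else 0) * v (Suc (Suc k)) * v j) = 2 * (- 3) ^ k * s"
      unfolding split by (simp_all add: v_def)
    ultimately show ?thesis unfolding quad_form_def by (subst split) simp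
  qed
  have "quad_form (k + 3) (\<lambda>i j. A i j ^ k) v
      = quad_form (k + 3) (\<lambda>i j. f (A i j)) v + quad_form (k + 3) (\<lambda>i j. if ?bad i j then 2 * (- 3) ^ k else 0) v"
    unfolding quad_form_add[symmetric] by (rule quad_form_cong) (simp_all add: fA)
  moreover have "(- 3 :: real) ^ k * s = 3 ^ k"
    by (simp add: s_def power_mult_distrib[symmetric])
  ultimately have "quad_form (k + 3) (\<lambda>i j. f (A i j)) v = - 4 * 3 ^ k"
    using poly0 bad by (simp add: mult.assoc)
  then have "quad_form (k + 3) (\<lambda>i j. f (A i j)) v < 0" by simp
  then have "\<not> pos_semidef (k + 3) (\<lambda>i j. f (A i j))"
    using pos_semidef_quad_form[of "k + 3" "\<lambda>i j. f (A i j)" v] by linarith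
  moreover have "pos_semidef n A" for n
    unfolding A_def by (rule pos_semidef_const_add_rank_one) simp
  ultimately show ?thesis by (intro exI[of _ A]) simp
qed

text \<open>
  The hypothesis on integer exponents says that \<open>f\<close> is the power function of the wrong parity
  there, so the lemma applies to \<open>phi\<close> and \<open>psi\<close> alike.
\<close>
lemma power_not_pos_semidef:
  assumes \<alpha>: "\<alpha> \<noteq> 0" "\<alpha> < real n - 2" and n: "2 \<le> n"
    and f: "\<And>t. 0 < t \<Longrightarrow> f t = t powr \<alpha>"
    and int: "\<And>k. 0 < k \<Longrightarrow> \<alpha> = real k \<Longrightarrow> (\<forall>t. f t = sgn t * t ^ k)"
  shows "\<exists>A. pos_semidef n A \<and> \<not> pos_semidef n (\<lambda>i j. f (A i j))"
proof -
  have *: "\<exists>A. pos_semidef n A \<and> \<not> pos_semidef n (\<lambda>i j. f (A i j))"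
    if "pos_semidef n A" "\<not> pos_semidef k (\<lambda>i j. f (A i j))" "k \<le> n" for A k
    using that pos_semidef_mono by blast
  define p where "p = nat \<lfloor>\<alpha>\<rfloor>"
  consider "\<alpha> < 0" | "0 < \<alpha>" "\<alpha> = real p" | "real p < \<alpha>" "\<alpha> < real p + 1"
    using \<alpha>(1) unfolding p_def by linarith
  then show ?thesis
  proof cases
    case 1
    have f12: "f 1 = 1" "f 2 = 2 powr \<alpha>" using f by simp_all
    note neg = negative_power_not_pos_semidef[OF 1, of f, OF f12]
    show ?thesis using neg n by (rule *)
  next
    case 2
    then have "\<forall>t. f t = sgn t * t ^ p" by (intro int) auto
    then have "\<exists>A. (\<forall>n. pos_semidef n A) \<and> \<not> pos_semidef (p + 3) (\<lambda>i j. f (A i j))"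
      by (intro sgn_power_not_pos_semidef) simp
    then obtain A where A: "pos_semidef n A" "\<not> pos_semidef (p + 3) (\<lambda>i j. f (A i j))" by auto
    have "p + 3 \<le> n" using 2 \<alpha>(2) by linarith
    with A show ?thesis by (rule *)
  next
    case 3
    then have "\<exists>A. (\<forall>n. pos_semidef n A) \<and> \<not> pos_semidef (p + 3) (\<lambda>i j. f (A i j))"
      using f by (rule nonint_power_not_pos_semidef)
    then obtain A where A: "pos_semidef n A" "\<not> pos_semidef (p + 3) (\<lambda>i j. f (A i j))" by auto
    have "p + 3 \<le> n" using 3 \<alpha>(2) by linarith
    with A show ?thesis by (rule *)
  qed
qed

section \<open>Adjoints and unitary conjugation\<close>

lemma dim_mat_adjoint [simp]:
  "dim_row (mat_adjoint A) = dim_col A" "dim_col (mat_adjoint A) = dim_row A"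
  by (simp_all add: mat_adjoint_def)

lemma index_mat_adjoint:
  fixes A :: "complex mat"
  assumes "i < dim_col A" "j < dim_row A"
  shows "mat_adjoint A $$ (i, j) = cnj (A $$ (j, i))"
  using assms by (simp add: mat_adjoint_def mat_of_rows_index)

lemma mat_adjoint_adjoint: "mat_adjoint (mat_adjoint A) = (A :: complex mat)"
  by (rule eq_matI) (simp_all add: index_mat_adjoint)

lemma mat_adjoint_mult:
  fixes A B :: "complex mat"
  assumes "A \<in> carrier_mat n k" "B \<in> carrier_mat k l"
  shows "mat_adjoint (A * B) = mat_adjoint B * mat_adjoint A"
  using assms
  by (intro eq_matI) (auto simp: index_mat_adjoint scalar_prod_def mult.commute intro!: sum.cong)

lemma mat_adjoint_one: "mat_adjoint (1\<^sub>m n) = (1\<^sub>m n :: complex mat)"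
  by (rule eq_matI) (auto simp: index_mat_adjoint)

lemma mat_adjoint_real_diag: "mat_adjoint (real_diag n d) = real_diag n d"
  by (rule eq_matI) (auto simp: index_mat_adjoint real_diag_def mat_diag_def)

lemma real_diag_mult: "real_diag n d * real_diag n e = real_diag n (\<lambda>i. d i * e i)"
  by (simp add: real_diag_def mat_diag_diag)

lemma hermitian_mats_carrier: "A \<in> hermitian_mats n \<Longrightarrow> A \<in> carrier_mat n n"
  by (simp add: hermitian_mats_def)

lemma unitary_mats_carrier: "U \<in> unitary_mats n \<Longrightarrow> U \<in> carrier_mat n n"
  by (simp add: unitary_mats_def)

lemma unitary_mats_adjoint: "U \<in> unitary_mats n \<Longrightarrow> mat_adjoint U \<in> unitary_mats n"
  by (auto simp: unitary_mats_def mat_adjoint_adjoint)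

lemma unitary_matsI:
  assumes "U \<in> carrier_mat n n" "mat_adjoint U * U = 1\<^sub>m n"
  shows "U \<in> unitary_mats n"
  using assms mat_mult_left_right_inverse[of "mat_adjoint U" n U]
  by (simp add: unitary_mats_def mat_adjoint_carrier)

lemma unitary_mats_mult:
  assumes "U \<in> unitary_mats n" "V \<in> unitary_mats n"
  shows "U * V \<in> unitary_mats n"
proof (rule unitary_matsI)
  note c = assms[THEN unitary_mats_carrier] assms[THEN unitary_mats_adjoint, THEN unitary_mats_carrier]
  have "mat_adjoint (U * V) * (U * V) = mat_adjoint V * (mat_adjoint U * U) * V"
    using c by (simp add: mat_adjoint_mult[of _ n n _ n] assoc_mult_mat[of _ n n _ n _ n]
        mult_carrier_mat[of _ n n _ n])
  then show "mat_adjoint (U * V) * (U * V) = 1\<^sub>m n"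
    using assms c by (simp add: unitary_mats_def)
qed (use assms[THEN unitary_mats_carrier] in auto)

definition unitary_conj :: "complex mat \<Rightarrow> complex mat \<Rightarrow> complex mat" where
  "unitary_conj U X = U * X * mat_adjoint U"

context
  fixes U :: "complex mat" and n :: nat
  assumes U: "U \<in> unitary_mats n"
begin

lemma unitary_conj_carrier: "X \<in> carrier_mat n n \<Longrightarrow> unitary_conj U X \<in> carrier_mat n n"
  using U unfolding unitary_conj_def
  by (meson mat_adjoint_carrier mult_carrier_mat unitary_mats_carrier)

lemma unitary_conj_mult:
  assumes "X \<in> carrier_mat n n" "Y \<in> carrier_mat n n"
  shows "unitary_conj U X * unitary_conj U Y = unitary_conj U (X * Y)"
proof -
  note c = assms unitary_mats_carrier[OF U] mat_adjoint_carrier[OF unitary_mats_carrier[OF U]]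
  have "unitary_conj U X * unitary_conj U Y = U * X * (mat_adjoint U * U) * Y * mat_adjoint U"
    unfolding unitary_conj_def
    using c by (simp add: assoc_mult_mat[of _ n n _ n _ n] mult_carrier_mat[of _ n n _ n])
  also have "\<dots> = U * X * Y * mat_adjoint U" using U c by (simp add: unitary_mats_def)
  finally show ?thesis
    unfolding unitary_conj_def
    using c by (simp add: assoc_mult_mat[of _ n n _ n _ n] mult_carrier_mat[of _ n n _ n])
qed

lemma unitary_conj_inverse:
  assumes "X \<in> carrier_mat n n"
  shows "unitary_conj (mat_adjoint U) (unitary_conj U X) = X"
    "unitary_conj U (unitary_conj (mat_adjoint U) X) = X"
proof -
  note c = assms unitary_mats_carrier[OF U] mat_adjoint_carrier[OF unitary_mats_carrier[OF U]]
  have "unitary_conj (mat_adjoint U) (unitary_conj U X) = mat_adjoint U * U * X * (mat_adjoint U * U)"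
    "unitary_conj U (unitary_conj (mat_adjoint U) X) = U * mat_adjoint U * X * (U * mat_adjoint U)"
    unfolding unitary_conj_def mat_adjoint_adjoint
    using c by (simp_all add: assoc_mult_mat[of _ n n _ n _ n] mult_carrier_mat[of _ n n _ n])
  moreover have "mat_adjoint U * U = 1\<^sub>m n" "U * mat_adjoint U = 1\<^sub>m n"
    using U by (simp_all add: unitary_mats_def)
  ultimately have "unitary_conj (mat_adjoint U) (unitary_conj U X) = 1\<^sub>m n * X * 1\<^sub>m n"
    "unitary_conj U (unitary_conj (mat_adjoint U) X) = 1\<^sub>m n * X * 1\<^sub>m n" by presburger+
  then show "unitary_conj (mat_adjoint U) (unitary_conj U X) = X"
    "unitary_conj U (unitary_conj (mat_adjoint U) X) = X"
    using assms by simp_all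
qed

lemma mat_adjoint_unitary_conj:
  assumes "X \<in> carrier_mat n n"
  shows "mat_adjoint (unitary_conj U X) = unitary_conj U (mat_adjoint X)"
proof -
  note c = assms mat_adjoint_carrier[OF assms] unitary_mats_carrier[OF U]
    mat_adjoint_carrier[OF unitary_mats_carrier[OF U]]
  show ?thesis unfolding unitary_conj_def
    using c by (simp add: mat_adjoint_mult[of _ n n _ n] mat_adjoint_adjoint
        assoc_mult_mat[of _ n n _ n _ n] mult_carrier_mat[of _ n n _ n])
qed

lemma unitary_conj_hermitian: "X \<in> hermitian_mats n \<Longrightarrow> unitary_conj U X \<in> hermitian_mats n"
  by (auto simp: hermitian_mats_def mat_adjoint_unitary_conj unitary_conj_carrier)

lemma unitary_conj_conj:
  assumes "V \<in> unitary_mats n" "X \<in> carrier_mat n n"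
  shows "unitary_conj U (unitary_conj V X) = unitary_conj (U * V) X"
proof -
  note c = assms(2) unitary_mats_carrier[OF U] mat_adjoint_carrier[OF unitary_mats_carrier[OF U]]
    unitary_mats_carrier[OF assms(1)] mat_adjoint_carrier[OF unitary_mats_carrier[OF assms(1)]]
  show ?thesis unfolding unitary_conj_def
    using c by (simp add: mat_adjoint_mult[of _ n n _ n]
        assoc_mult_mat[of _ n n _ n _ n] mult_carrier_mat[of _ n n _ n])
qed

end

section \<open>Simultaneous diagonalization of commuting Hermitian matrices\<close>

text \<open>The direct sum of a one-dimensional block and \<open>A\<close>, with the new index in front.\<close>
definition bordered :: "complex \<Rightarrow> complex mat \<Rightarrow> complex mat" where
  "bordered c A = mat (Suc (dim_row A)) (Suc (dim_col A))
     (\<lambda>(i, j). case i of 0 \<Rightarrow> (case j of 0 \<Rightarrow> c | Suc _ \<Rightarrow> 0)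
                       | Suc i' \<Rightarrow> (case j of 0 \<Rightarrow> 0 | Suc j' \<Rightarrow> A $$ (i', j')))"

lemma bordered_carrier: "A \<in> carrier_mat n n \<Longrightarrow> bordered c A \<in> carrier_mat (Suc n) (Suc n)"
  by (auto simp: bordered_def)

lemma bordered_mult:
  assumes "A \<in> carrier_mat n n" "B \<in> carrier_mat n n"
  shows "bordered a A * bordered b B = bordered (a * b) (A * B)"
proof (rule eq_matI)
  fix i j assume "i < dim_row (bordered (a * b) (A * B))" "j < dim_col (bordered (a * b) (A * B))"
  then have "i < Suc n" "j < Suc n" using assms by (auto simp: bordered_def)
  then show "(bordered a A * bordered b B) $$ (i, j) = bordered (a * b) (A * B) $$ (i, j)"
    using assms
    by (cases i; cases j)
      (simp_all add: bordered_def scalar_prod_def sum.atLeast0_lessThan_Suc_shift del: sum.op_ivl_Suc)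
qed (use assms in \<open>simp_all add: bordered_def\<close>)

lemma mat_adjoint_bordered: "mat_adjoint (bordered c A) = bordered (cnj c) (mat_adjoint A)"
  by (rule eq_matI) (auto simp: bordered_def index_mat_adjoint split: nat.splits)

lemma bordered_one: "bordered 1 (1\<^sub>m n) = 1\<^sub>m (Suc n)"
  by (rule eq_matI) (auto simp: bordered_def split: nat.splits)

lemma bordered_real_diag:
  "bordered (complex_of_real c) (real_diag n d) = real_diag (Suc n) (case_nat c d)"
  by (rule eq_matI) (auto simp: bordered_def real_diag_def mat_diag_def split: nat.splits)

lemma bordered_inject:
  assumes "A \<in> carrier_mat n n" "B \<in> carrier_mat n n" "bordered a A = bordered b B"
  shows "a = b" "A = B"
proof -
  show "a = b" using arg_cong[OF assms(3), of "\<lambda>M. M $$ (0, 0)"] by (simp add: bordered_def)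
  have "A $$ (i, j) = B $$ (i, j)" if "i < n" "j < n" for i j
    using arg_cong[OF assms(3), of "\<lambda>M. M $$ (Suc i, Suc j)"] assms(1,2) that
    by (simp add: bordered_def)
  then show "A = B" using assms(1,2) by (intro eq_matI) auto
qed

lemma bordered_unitary:
  assumes "V \<in> unitary_mats n"
  shows "bordered 1 V \<in> unitary_mats (Suc n)"
proof (rule unitary_matsI)
  have c: "V \<in> carrier_mat n n" "mat_adjoint V \<in> carrier_mat n n"
    using assms unitary_mats_adjoint unitary_mats_carrier by blast+
  then show "bordered 1 V \<in> carrier_mat (Suc n) (Suc n)" by (intro bordered_carrier)
  show "mat_adjoint (bordered 1 V) * bordered 1 V = 1\<^sub>m (Suc n)"
    using assms by (simp add: mat_adjoint_bordered bordered_mult[OF c(2,1)] bordered_one unitary_mats_def)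
qed

text \<open>The eigenvector equation clears the first column, and self-adjointness then clears the first row.\<close>
lemma hermitian_deflate:
  assumes C: "C \<in> hermitian_mats (Suc n)" and eig: "C *\<^sub>v unit_vec (Suc n) 0 = \<chi> \<cdot>\<^sub>v unit_vec (Suc n) 0"
  obtains c C' where "C' \<in> hermitian_mats n" "C = bordered (complex_of_real c) C'"
proof -
  have carr: "C \<in> carrier_mat (Suc n) (Suc n)" using C by (rule hermitian_mats_carrier)
  have sym: "C $$ (i, j) = cnj (C $$ (j, i))" if "i < Suc n" "j < Suc n" for i j
    using C carr that index_mat_adjoint[of i C j] by (simp add: hermitian_mats_def)
  have col: "C $$ (i, 0) = 0" if "0 < i" "i < Suc n" for i
    using arg_cong[OF eig, of "\<lambda>v. v $ i"] that carr by simp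
  have row: "C $$ (0, i) = 0" if "0 < i" "i < Suc n" for i
    using sym[of 0 i] col[OF that] that by simp
  define C' where "C' = mat n n (\<lambda>(i, j). C $$ (Suc i, Suc j))"
  have "C' \<in> hermitian_mats n"
    unfolding hermitian_mats_def C'_def
    by (auto intro!: eq_matI simp: index_mat_adjoint sym[symmetric])
  moreover have "C $$ (0, 0) = complex_of_real (Re (C $$ (0, 0)))"
    using sym[of 0 0] by (simp add: complex_eq_iff)
  then have "C = bordered (complex_of_real (Re (C $$ (0, 0)))) C'"
    using carr col row by (intro eq_matI) (auto simp: bordered_def C'_def split: nat.splits)
  ultimately show ?thesis using that by blast
qed

text \<open>
  Gram-Schmidt applied to a basis starting with \<open>u\<close> gives orthogonal columns, which only have
  to be normalized.
\<close>
lemma unitary_completion: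
  assumes u: "u \<in> carrier_vec n" "u \<noteq> 0\<^sub>v n"
  obtains W c where "W \<in> unitary_mats n" "c \<noteq> 0" "u = c \<cdot>\<^sub>v (W *\<^sub>v unit_vec n 0)"
proof -
  interpret cof_vec_space n "TYPE(complex)" .
  define ws where "ws = gram_schmidt n (basis_completion u)"
  note b = basis_completion[OF u]
  have ws: "set ws \<subseteq> carrier_vec n" "corthogonal ws" "length ws = n"
    using gram_schmidt_result[OF b(2,4,5) ws_def] b(6) by auto
  have n: "0 < n"
  proof (rule ccontr)
    assume "\<not> 0 < n"
    then have "u = 0\<^sub>v n" using u(1) by (intro eq_vecI) auto
    then show False using u(2) by simp
  qed
  obtain vs where vs: "basis_completion u = u # vs"
    using b(6,7) n by (cases "basis_completion u") auto
  have "hd ws = u" unfolding ws_def vs by (rule gram_schmidt_hd[OF u(1)])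
  then have ws0: "ws ! 0 = u" using n ws(3) by (metis hd_conv_nth length_0_conv not_gr0)
  have wsc: "ws ! j \<in> carrier_vec n" if "j < n" for j using ws that by auto
  define r where "r j = sqrt (Re (ws ! j \<bullet>c ws ! j))" for j
  have rr: "complex_of_real (r j) * complex_of_real (r j) = ws ! j \<bullet>c ws ! j" and r0: "r j \<noteq> 0"
    if "j < n" for j
  proof -
    have "ws ! j \<bullet>c ws ! j \<noteq> 0" using corthogonalD[OF ws(2), of j j] ws(3) that by simp
    moreover have "0 \<le> ws ! j \<bullet>c ws ! j" by (rule conjugate_square_ge_0_vec)
    ultimately show "complex_of_real (r j) * complex_of_real (r j) = ws ! j \<bullet>c ws ! j" "r j \<noteq> 0"
      unfolding r_def of_real_mult[symmetric]
      by (auto simp: less_eq_complex_def complex_eq_iff)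
  qed
  define W where "W = mat n n (\<lambda>(i, j). ws ! j $ i / complex_of_real (r j))"
  have "W \<in> unitary_mats n"
  proof (rule unitary_matsI)
    show "mat_adjoint W * W = 1\<^sub>m n"
    proof (rule eq_matI)
      fix i j assume "i < dim_row (1\<^sub>m n :: complex mat)" "j < dim_col (1\<^sub>m n :: complex mat)"
      then have ij: "i < n" "j < n" by auto
      have "(mat_adjoint W * W) $$ (i, j)
          = (\<Sum>l<n. cnj (ws ! i $ l / complex_of_real (r i)) * (ws ! j $ l / complex_of_real (r j)))"
        using ij by (simp add: scalar_prod_def W_def index_mat_adjoint atLeast0LessThan)
      also have "\<dots> = (ws ! j \<bullet>c ws ! i) / (complex_of_real (r i) * complex_of_real (r j))"
        using wsc[OF ij(1)] wsc[OF ij(2)]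
        by (simp add: scalar_prod_def sum_divide_distrib atLeast0LessThan mult.commute)
      also have "\<dots> = (1\<^sub>m n :: complex mat) $$ (i, j)"
        using ij corthogonalD[OF ws(2), of j i] ws(3) rr[OF ij(1)] r0[OF ij(1)] by auto
      finally show "(mat_adjoint W * W) $$ (i, j) = (1\<^sub>m n :: complex mat) $$ (i, j)" .
    qed (simp_all add: W_def)
  qed (simp add: W_def)
  moreover have "u = complex_of_real (r 0) \<cdot>\<^sub>v (W *\<^sub>v unit_vec n 0)"
    using n u r0[OF n] by (intro eq_vecI) (auto simp: W_def ws0)
  ultimately show ?thesis using that[of W "complex_of_real (r 0)"] r0[OF n] by auto
qed

definition simultaneously_diagonalizable :: "nat \<Rightarrow> complex mat set \<Rightarrow> bool" where
  "simultaneously_diagonalizable n F \<longleftrightarrow>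
     (\<exists>U\<in>unitary_mats n. \<forall>B\<in>F. \<exists>d. B = unitary_conj U (real_diag n d))"

text \<open>
  A common eigenvector splits off a one-dimensional direct summand from all matrices of the
  family; the complementary summands are again Hermitian and commute.
\<close>
lemma simultaneously_diagonalizable_Suc:
  assumes IH: "\<And>G. finite G \<Longrightarrow> G \<subseteq> hermitian_mats n \<Longrightarrow> (\<forall>A\<in>G. \<forall>B\<in>G. A * B = B * A)
      \<Longrightarrow> simultaneously_diagonalizable n G"
    and F: "finite F" "F \<subseteq> hermitian_mats (Suc n)" "\<forall>A\<in>F. \<forall>B\<in>F. A * B = B * A"
    and u: "u \<in> carrier_vec (Suc n)" "u \<noteq> 0\<^sub>v (Suc n)" "\<forall>B\<in>F. \<exists>\<chi>. B *\<^sub>v u = \<chi> \<cdot>\<^sub>v u"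
  shows "simultaneously_diagonalizable (Suc n) F"
proof -
  let ?N = "Suc n"
  obtain W k where W: "W \<in> unitary_mats ?N" and k: "k \<noteq> 0" and uk: "u = k \<cdot>\<^sub>v (W *\<^sub>v unit_vec ?N 0)"
    using unitary_completion[OF u(1,2)] .
  let ?W' = "mat_adjoint W"
  note W' = unitary_mats_adjoint[OF W]
  note cW = unitary_mats_carrier[OF W] unitary_mats_carrier[OF W']
  have Fc: "B \<in> carrier_mat ?N ?N" if "B \<in> F" for B using F(2) that hermitian_mats_carrier by blast
  have "\<exists>c T. T \<in> hermitian_mats n \<and> unitary_conj ?W' B = bordered (complex_of_real c) T" if B: "B \<in> F" for B
  proof -
    let ?e = "unit_vec ?N 0 :: complex vec"
    obtain \<chi> where \<chi>: "B *\<^sub>v u = \<chi> \<cdot>\<^sub>v u" using u(3) B by blast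
    have We: "W *\<^sub>v ?e = (1 / k) \<cdot>\<^sub>v u"
      using k cW by (simp add: uk smult_smult_assoc)
    have "unitary_conj ?W' B *\<^sub>v ?e = ?W' *\<^sub>v (B *\<^sub>v (W *\<^sub>v ?e))"
      unfolding unitary_conj_def mat_adjoint_adjoint using cW Fc[OF B]
      by (simp add: assoc_mult_mat_vec[of _ ?N ?N _ ?N] mult_carrier_mat[of _ ?N ?N _ ?N])
    also have "B *\<^sub>v (W *\<^sub>v ?e) = \<chi> \<cdot>\<^sub>v (W *\<^sub>v ?e)"
      unfolding We using mult_mat_vec[OF Fc[OF B] u(1)] \<chi> by (simp add: smult_smult_assoc mult.commute)
    also have "?W' *\<^sub>v (\<chi> \<cdot>\<^sub>v (W *\<^sub>v ?e)) = \<chi> \<cdot>\<^sub>v ((?W' * W) *\<^sub>v ?e)"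
      using cW by (simp add: mult_mat_vec[of _ ?N ?N] assoc_mult_mat_vec[of _ ?N ?N _ ?N])
    also have "\<dots> = \<chi> \<cdot>\<^sub>v ?e" using W by (simp add: unitary_mats_def)
    finally have eig: "unitary_conj ?W' B *\<^sub>v ?e = \<chi> \<cdot>\<^sub>v ?e" .
    have "unitary_conj ?W' B \<in> hermitian_mats ?N" using unitary_conj_hermitian[OF W'] B F(2) by blast
    then obtain T c where "T \<in> hermitian_mats n" "unitary_conj ?W' B = bordered (complex_of_real c) T"
      using eig by (rule hermitian_deflate)
    then show ?thesis by blast
  qed
  then obtain c T where T: "\<And>B. B \<in> F \<Longrightarrow> T B \<in> hermitian_mats n"
    and cT: "\<And>B. B \<in> F \<Longrightarrow> unitary_conj ?W' B = bordered (complex_of_real (c B)) (T B)"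
    by metis
  note Tc = hermitian_mats_carrier[OF T]
  have "T A * T B = T B * T A" if "A \<in> F" "B \<in> F" for A B
  proof -
    have "unitary_conj ?W' A * unitary_conj ?W' B = unitary_conj ?W' B * unitary_conj ?W' A"
      using F(3) that Fc by (simp only: unitary_conj_mult[OF W'])
    then have "bordered (complex_of_real (c A) * complex_of_real (c B)) (T A * T B)
        = bordered (complex_of_real (c B) * complex_of_real (c A)) (T B * T A)"
      using that Tc by (simp add: cT bordered_mult[of _ n])
    then show ?thesis using bordered_inject(2)[of _ n] Tc that mult_carrier_mat by metis
  qed
  then have "simultaneously_diagonalizable n (T ` F)"
    using F(1) T by (intro IH) auto
  then obtain V where V: "V \<in> unitary_mats n" and "\<forall>B\<in>F. \<exists>d. T B = unitary_conj V (real_diag n d)"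
    unfolding simultaneously_diagonalizable_def by blast
  then obtain d where d: "\<And>B. B \<in> F \<Longrightarrow> T B = unitary_conj V (real_diag n (d B))" by metis
  note bV = bordered_unitary[OF V]
  note cV = unitary_mats_carrier[OF V] unitary_mats_carrier[OF unitary_mats_adjoint[OF V]]
  have "B = unitary_conj (W * bordered 1 V) (real_diag ?N (case_nat (c B) (d B)))" if "B \<in> F" for B
  proof -
    have "bordered (complex_of_real (c B)) (unitary_conj V (real_diag n (d B)))
        = unitary_conj (bordered 1 V) (bordered (complex_of_real (c B)) (real_diag n (d B)))"
      unfolding unitary_conj_def
      using cV by (simp add: mat_adjoint_bordered bordered_mult[of _ n] real_diag_carrier
          mult_carrier_mat[of _ n n _ n])
    then have "unitary_conj ?W' B = unitary_conj (bordered 1 V) (real_diag ?N (case_nat (c B) (d B)))"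
      using that by (simp add: cT d bordered_real_diag)
    then have "unitary_conj W (unitary_conj ?W' B)
        = unitary_conj (W * bordered 1 V) (real_diag ?N (case_nat (c B) (d B)))"
      using unitary_conj_conj[OF W bV real_diag_carrier] by simp
    then show ?thesis using unitary_conj_inverse(2)[OF W Fc[OF that]] by simp
  qed
  then show ?thesis
    unfolding simultaneously_diagonalizable_def using unitary_mats_mult[OF W bV] by blast
qed

text \<open>
  A common eigenvector \<open>v\<close> of all previous matrices is projected to an eigenspace of the next matrix
  \<open>B\<close> that \<open>v\<close> is not orthogonal to. The projection \<open>Q\<close> is a function of \<open>B\<close>, hence commutes with
  everything that commutes with \<open>B\<close>, and so preserves the previous eigenvector equations.
\<close>
lemma commuting_common_eigenvector:
  assumes single: "\<And>B. B \<in> hermitian_mats n \<Longrightarrow> simultaneously_diagonalizable n {B}"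
    and n: "0 < n"
    and F: "finite F" "F \<subseteq> hermitian_mats n" "\<forall>A\<in>F. \<forall>B\<in>F. A * B = B * A"
  shows "\<exists>u\<in>carrier_vec n. u \<noteq> 0\<^sub>v n \<and> (\<forall>B\<in>F. \<exists>\<chi>. B *\<^sub>v u = \<chi> \<cdot>\<^sub>v u)"
  using F
proof (induction F rule: finite_induct)
  case empty
  have "unit_vec n 0 \<noteq> (0\<^sub>v n :: complex vec)"
  proof
    assume "unit_vec n 0 = (0\<^sub>v n :: complex vec)"
    from arg_cong[OF this, of "\<lambda>v. v $ 0"] n show False by simp
  qed
  then show ?case by (intro bexI[of _ "unit_vec n 0"]) auto
next
  case (insert B F)
  then obtain v where v: "v \<in> carrier_vec n" "v \<noteq> 0\<^sub>v n" "\<forall>A\<in>F. \<exists>\<chi>. A *\<^sub>v v = \<chi> \<cdot>\<^sub>v v" by auto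
  have B: "B \<in> hermitian_mats n" and Bc: "B \<in> carrier_mat n n"
    using insert.prems hermitian_mats_carrier by auto
  obtain U d where U: "U \<in> unitary_mats n" and Bd: "B = unitary_conj U (real_diag n d)"
    using single[OF B] by (auto simp: simultaneously_diagonalizable_def)
  let ?U' = "mat_adjoint U"
  note cU = unitary_mats_carrier[OF U] unitary_mats_carrier[OF unitary_mats_adjoint[OF U]]
  define a where "a = ?U' *\<^sub>v v"
  have ac: "a \<in> carrier_vec n" using cU v by (simp add: a_def)
  have "U *\<^sub>v a = (U * ?U') *\<^sub>v v" unfolding a_def
    using cU v(1) by (simp add: assoc_mult_mat_vec[of _ n n _ n])
  then have "U *\<^sub>v a = v" using U v(1) by (simp add: unitary_mats_def)
  then have "a \<noteq> 0\<^sub>v n" using v(2) cU by (auto intro!: eq_vecI)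
  then obtain i where i: "i < n" "a $ i \<noteq> 0" using ac by (metis eq_vecI carrier_vecD index_zero_vec)
  define g :: "real \<Rightarrow> real" where "g y = (if y = d i then 1 else 0)" for y
  define Q where "Q = unitary_conj U (real_diag n (g \<circ> d))"
  have Qc: "Q \<in> carrier_mat n n" unfolding Q_def by (intro unitary_conj_carrier U real_diag_carrier)
  have BQ: "B * Q = complex_of_real (d i) \<cdot>\<^sub>m Q"
  proof -
    have "real_diag n d * real_diag n (g \<circ> d) = complex_of_real (d i) \<cdot>\<^sub>m real_diag n (g \<circ> d)"
      unfolding real_diag_mult by (rule eq_matI) (auto simp: real_diag_def mat_diag_def g_def)
    then have "B * Q = unitary_conj U (complex_of_real (d i) \<cdot>\<^sub>m real_diag n (g \<circ> d))"
      unfolding Bd Q_def by (simp add: unitary_conj_mult[OF U] real_diag_carrier)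
    also have "\<dots> = complex_of_real (d i) \<cdot>\<^sub>m Q"
      unfolding Q_def unitary_conj_def using cU real_diag_carrier[of n "g \<circ> d"]
      by (simp add: mult_smult_distrib[of _ n n _ n] mult_smult_assoc_mat[of _ n n _ n] mult_carrier_mat[of _ n n _ n])
    finally show ?thesis .
  qed
  have AQ: "A * Q = Q * A" if A: "A \<in> F" for A
  proof -
    have Ac: "A \<in> carrier_mat n n" using insert.prems A hermitian_mats_carrier by auto
    let ?W = "unitary_conj ?U' A"
    note U' = unitary_mats_adjoint[OF U]
    have Wc: "?W \<in> carrier_mat n n" by (rule unitary_conj_carrier[OF U' Ac])
    have "A * B = B * A" using insert.prems(2) A by blast
    then have "unitary_conj ?U' (A * B) = unitary_conj ?U' (B * A)" by (rule arg_cong)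
    then have "?W * real_diag n d = real_diag n d * ?W"
      using unitary_conj_mult[OF U' Ac Bc] unitary_conj_mult[OF U' Bc Ac]
        unitary_conj_inverse(1)[OF U real_diag_carrier] by (simp add: Bd)
    then have "?W * real_diag n (g \<circ> d) = real_diag n (g \<circ> d) * ?W"
      by (rule real_diag_intertwine[OF Wc])
    then have "unitary_conj U (?W * real_diag n (g \<circ> d)) = unitary_conj U (real_diag n (g \<circ> d) * ?W)" by simp
    then show ?thesis
      using unitary_conj_inverse(2)[OF U Ac]
      by (simp add: unitary_conj_mult[OF U, symmetric] Wc real_diag_carrier Q_def)
  qed
  define w where "w = Q *\<^sub>v v"
  have "w \<noteq> 0\<^sub>v n"
  proof
    assume "w = 0\<^sub>v n"
    then have "?U' *\<^sub>v w = 0\<^sub>v n" using cU by (auto intro!: eq_vecI)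
    moreover have "?U' *\<^sub>v w = (?U' * U) *\<^sub>v (real_diag n (g \<circ> d) *\<^sub>v a)"
      unfolding w_def Q_def a_def unitary_conj_def using cU v(1) real_diag_carrier[of n "g \<circ> d"]
      by (simp add: assoc_mult_mat_vec[of _ n n _ n] mult_carrier_mat[of _ n n _ n])
    moreover have "\<dots> = real_diag n (g \<circ> d) *\<^sub>v a"
      using U ac real_diag_carrier[of n "g \<circ> d"] by (simp add: unitary_mats_def)
    moreover have "(real_diag n (g \<circ> d) *\<^sub>v a) $ i = a $ i"
    proof -
      have "(real_diag n (g \<circ> d) *\<^sub>v a) $ i
          = (\<Sum>j<n. (if i = j then complex_of_real (g (d j)) else 0) * a $ j)"
        using i(1) ac by (simp add: real_diag_def mat_diag_def scalar_prod_def atLeast0LessThan)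
      also have "\<dots> = (\<Sum>j<n. if i = j then a $ j else 0)"
        by (intro sum.cong) (auto simp: g_def)
      finally show ?thesis using i(1) by simp
    qed
    ultimately show False using i by simp
  qed
  moreover have "\<exists>\<chi>. A *\<^sub>v w = \<chi> \<cdot>\<^sub>v w" if "A \<in> insert B F" for A
  proof (cases "A = B")
    case True
    have "B *\<^sub>v w = (B * Q) *\<^sub>v v" unfolding w_def using Bc Qc v(1) by simp
    also have "\<dots> = complex_of_real (d i) \<cdot>\<^sub>v w"
      unfolding BQ w_def using Qc v(1) by (auto intro!: eq_vecI)
    finally show ?thesis using True by blast
  next
    case False
    then have A: "A \<in> F" using that by simp
    then obtain \<chi> where \<chi>: "A *\<^sub>v v = \<chi> \<cdot>\<^sub>v v" using v(3) by blast
    have Ac: "A \<in> carrier_mat n n" using insert.prems A hermitian_mats_carrier by auto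
    have "A *\<^sub>v w = (Q * A) *\<^sub>v v" unfolding w_def AQ[OF A, symmetric] using Ac Qc v(1) by simp
    also have "\<dots> = \<chi> \<cdot>\<^sub>v w" using Ac Qc v(1) \<chi> by (simp add: w_def mult_mat_vec[OF Qc])
    finally show ?thesis by blast
  qed
  moreover have "w \<in> carrier_vec n" unfolding w_def using Qc v(1) by simp
  ultimately show ?case by blast
qed

text \<open>
  In each dimension the case of one matrix comes first: any eigenvector will do for the reduction
  step. It provides the spectral projections from which common eigenvectors of larger families
  are found.
\<close>
theorem commuting_hermitian_simultaneously_diagonalizable:
  assumes "finite F" "F \<subseteq> hermitian_mats n" "\<forall>A\<in>F. \<forall>B\<in>F. A * B = B * A"
  shows "simultaneously_diagonalizable n F"
  using assms
proof (induction n arbitrary: F)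
  case 0
  have one: "1\<^sub>m 0 \<in> unitary_mats 0" by (simp add: unitary_matsI mat_adjoint_one)
  have "B = unitary_conj (1\<^sub>m 0) (real_diag 0 d)" if "B \<in> F" for B d
    using 0 that hermitian_mats_carrier[of B 0] unitary_conj_carrier[OF one real_diag_carrier, of d]
    by (intro eq_matI) auto
  then show ?case unfolding simultaneously_diagonalizable_def using one by blast
next
  case (Suc n)
  have single: "simultaneously_diagonalizable (Suc n) {B}" if B: "B \<in> hermitian_mats (Suc n)" for B
  proof -
    have Bc: "B \<in> carrier_mat (Suc n) (Suc n)" using B by (rule hermitian_mats_carrier)
    then obtain \<chi> where "eigenvalue B \<chi>"
      using spectrum_non_empty[OF Bc] by (auto simp: spectrum_def)
    then obtain u where "u \<in> carrier_vec (Suc n)" "u \<noteq> 0\<^sub>v (Suc n)" "B *\<^sub>v u = \<chi> \<cdot>\<^sub>v u"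
      using Bc by (auto simp: eigenvalue_def eigenvector_def)
    then show ?thesis using B by (intro simultaneously_diagonalizable_Suc[OF Suc.IH]) auto
  qed
  from commuting_common_eigenvector[OF single _ Suc.prems] obtain u where
    "u \<in> carrier_vec (Suc n)" "u \<noteq> 0\<^sub>v (Suc n)" "\<forall>B\<in>F. \<exists>\<chi>. B *\<^sub>v u = \<chi> \<cdot>\<^sub>v u" by auto
  then show ?case using Suc.prems by (intro simultaneously_diagonalizable_Suc[OF Suc.IH]) auto
qed

section \<open>Block matrices with simultaneously diagonalized blocks\<close>

lemma index_unitary_conj_real_diag:
  assumes U: "U \<in> unitary_mats m" and "i < m" "j < m"
  shows "unitary_conj U (real_diag m d) $$ (i, j)
    = (\<Sum>c<m. U $$ (i, c) * complex_of_real (d c) * cnj (U $$ (j, c)))"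
proof -
  have c: "U \<in> carrier_mat m m" using U by (rule unitary_mats_carrier)
  then have "U * real_diag m d = mat m m (\<lambda>(i, j). U $$ (i, j) * complex_of_real (d j))"
    unfolding real_diag_def by (rule mat_diag_mult_right)
  then show ?thesis
    using c assms(2,3)
    by (simp add: unitary_conj_def scalar_prod_def index_mat_adjoint atLeast0LessThan)
qed

lemma sum_blocks:
  fixes F :: "nat \<Rightarrow> 'a :: comm_monoid_add"
  shows "(\<Sum>a<m * n. F a) = (\<Sum>s<n. \<Sum>i<m. F (s * m + i))"
proof -
  have "(\<Sum>a<n * m. F a) = (\<Sum>s<n. \<Sum>a = s * m..<s * m + m. F a)"
    by (rule sum.nat_group[symmetric])
  also have "\<dots> = (\<Sum>s<n. \<Sum>i<m. F (s * m + i))"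
    by (simp only: sum.atLeastLessThan_shift_0[of F] atLeast0LessThan comp_def add_diff_cancel_left')
  finally show ?thesis by (simp add: mult.commute)
qed

lemma block_index_bounds:
  assumes "a < m * (n::nat)"
  shows "a div m < n" "a mod m < m"
proof -
  have "0 < m" using assms by (cases m) auto
  then show "a div m < n" "a mod m < m"
    using assms by (simp_all add: less_mult_imp_div_less mult.commute)
qed

lemma block_index_less:
  assumes "s < n" "i < m"
  shows "s * m + i < m * (n::nat)"
proof -
  have "s * m + i < Suc s * m" using assms by simp
  also have "\<dots> \<le> n * m" using assms by (intro mult_le_mono1) simp
  finally show ?thesis by (simp add: mult.commute)
qed

lemma block_mat_cong:
  assumes "\<And>s t. s < n \<Longrightarrow> t < n \<Longrightarrow> G s t = H s t"
  shows "block_mat m n G = block_mat m n H"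
  unfolding block_mat_def using assms by (intro eq_matI) (auto simp: block_index_bounds)

lemma index_block_mat:
  assumes "s < n" "t < n" "i < m" "j < m"
  shows "block_mat m n G $$ (s * m + i, t * m + j) = G s t $$ (i, j)"
  using assms by (simp add: block_mat_def block_index_less)

text \<open>The coordinates of the \<open>s\<close>-th block of the vector \<open>x\<close> with respect to the columns of \<open>U\<close>.\<close>
definition eigen_coord :: "nat \<Rightarrow> complex mat \<Rightarrow> complex vec \<Rightarrow> nat \<Rightarrow> nat \<Rightarrow> complex" where
  "eigen_coord m U x s c = (\<Sum>j<m. cnj (U $$ (j, c)) * x $ (s * m + j))"

text \<open>
  In the coordinates given by \<open>U\<close> different eigenvalue indices \<open>c\<close> decouple, and for real
  coefficients real and imaginary parts decouple as well.
\<close>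
lemma block_form_eigen_coord:
  assumes U: "U \<in> unitary_mats m"
    and G: "\<And>s t. s < n \<Longrightarrow> t < n \<Longrightarrow> G s t = unitary_conj U (real_diag m (e s t))"
    and x: "x \<in> carrier_vec (m * n)"
  shows "Re ((block_mat m n G *\<^sub>v x) \<bullet>c x)
    = (\<Sum>c<m. quad_form n (\<lambda>s t. e s t c) (\<lambda>s. Re (eigen_coord m U x s c))
        + quad_form n (\<lambda>s t. e s t c) (\<lambda>s. Im (eigen_coord m U x s c)))"
proof -
  let ?y = "eigen_coord m U x"
  have "(block_mat m n G *\<^sub>v x) \<bullet>c x
      = (\<Sum>a<m * n. \<Sum>b<m * n. block_mat m n G $$ (a, b) * x $ b * cnj (x $ a))"
    using x by (simp add: scalar_prod_def block_mat_def atLeast0LessThan sum_distrib_right)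
  also have "\<dots> = (\<Sum>s<n. \<Sum>i<m. \<Sum>t<n. \<Sum>j<m.
      block_mat m n G $$ (s * m + i, t * m + j) * x $ (t * m + j) * cnj (x $ (s * m + i)))"
    by (simp only: sum_blocks)
  also have "\<dots> = (\<Sum>s<n. \<Sum>t<n. \<Sum>i<m. \<Sum>j<m.
      block_mat m n G $$ (s * m + i, t * m + j) * x $ (t * m + j) * cnj (x $ (s * m + i)))"
    by (intro sum.cong refl sum.swap)
  also have "\<dots> = (\<Sum>s<n. \<Sum>t<n. \<Sum>c<m. complex_of_real (e s t c) * (?y t c * cnj (?y s c)))"
  proof (rule sum.cong[OF refl], rule sum.cong[OF refl])
    fix s t assume "s \<in> {..<n}" "t \<in> {..<n}"
    then have st: "s < n" "t < n" by auto
    have "(\<Sum>i<m. \<Sum>j<m. block_mat m n G $$ (s * m + i, t * m + j) * x $ (t * m + j) * cnj (x $ (s * m + i)))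
        = (\<Sum>i<m. \<Sum>j<m. \<Sum>c<m. complex_of_real (e s t c) *
            ((cnj (U $$ (j, c)) * x $ (t * m + j)) * cnj (cnj (U $$ (i, c)) * x $ (s * m + i))))"
    proof (intro sum.cong refl)
      fix i j assume "i \<in> {..<m}" "j \<in> {..<m}"
      then have ij: "i < m" "j < m" by auto
      show "block_mat m n G $$ (s * m + i, t * m + j) * x $ (t * m + j) * cnj (x $ (s * m + i))
          = (\<Sum>c<m. complex_of_real (e s t c) *
              ((cnj (U $$ (j, c)) * x $ (t * m + j)) * cnj (cnj (U $$ (i, c)) * x $ (s * m + i))))"
        unfolding index_block_mat[OF st ij] G[OF st] index_unitary_conj_real_diag[OF U ij]
          sum_distrib_right
        by (intro sum.cong) (simp_all add: mult_ac)
    qed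
    also have "\<dots> = (\<Sum>i<m. \<Sum>c<m. \<Sum>j<m. complex_of_real (e s t c) *
            ((cnj (U $$ (j, c)) * x $ (t * m + j)) * cnj (cnj (U $$ (i, c)) * x $ (s * m + i))))"
      by (intro sum.cong refl sum.swap)
    also have "\<dots> = (\<Sum>c<m. \<Sum>i<m. \<Sum>j<m. complex_of_real (e s t c) *
            ((cnj (U $$ (j, c)) * x $ (t * m + j)) * cnj (cnj (U $$ (i, c)) * x $ (s * m + i))))"
      by (rule sum.swap)
    also have "\<dots> = (\<Sum>c<m. complex_of_real (e s t c) * (?y t c * cnj (?y s c)))"
    proof (intro sum.cong refl)
      fix c
      have "?y t c * cnj (?y s c) = (\<Sum>i<m. \<Sum>j<m.
          (cnj (U $$ (j, c)) * x $ (t * m + j)) * cnj (cnj (U $$ (i, c)) * x $ (s * m + i)))"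
        unfolding eigen_coord_def cnj_sum sum_product by (rule sum.swap)
      then show "(\<Sum>i<m. \<Sum>j<m. complex_of_real (e s t c) *
            ((cnj (U $$ (j, c)) * x $ (t * m + j)) * cnj (cnj (U $$ (i, c)) * x $ (s * m + i))))
          = complex_of_real (e s t c) * (?y t c * cnj (?y s c))"
        by (simp only: sum_distrib_left)
    qed
    finally show "(\<Sum>i<m. \<Sum>j<m. block_mat m n G $$ (s * m + i, t * m + j) * x $ (t * m + j) * cnj (x $ (s * m + i)))
        = (\<Sum>c<m. complex_of_real (e s t c) * (?y t c * cnj (?y s c)))" .
  qed
  also have "\<dots> = (\<Sum>s<n. \<Sum>c<m. \<Sum>t<n. complex_of_real (e s t c) * (?y t c * cnj (?y s c)))"
    by (intro sum.cong refl sum.swap)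
  also have "\<dots> = (\<Sum>c<m. \<Sum>s<n. \<Sum>t<n. complex_of_real (e s t c) * (?y t c * cnj (?y s c)))"
    by (rule sum.swap)
  finally have "Re ((block_mat m n G *\<^sub>v x) \<bullet>c x)
      = (\<Sum>c<m. \<Sum>s<n. \<Sum>t<n. e s t c * (Re (?y t c) * Re (?y s c) + Im (?y t c) * Im (?y s c)))"
    by simp
  also have "\<dots> = (\<Sum>c<m. \<Sum>s<n. \<Sum>t<n. e s t c * Re (?y s c) * Re (?y t c)
      + e s t c * Im (?y s c) * Im (?y t c))"
    by (intro sum.cong refl) (simp add: distrib_left mult_ac)
  finally show ?thesis by (simp only: quad_form_def sum.distrib)
qed

lemma block_mat_hermitian:
  assumes U: "U \<in> unitary_mats m"
    and G: "\<And>s t. s < n \<Longrightarrow> t < n \<Longrightarrow> G s t = unitary_conj U (real_diag m (e s t))"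
    and sym: "\<And>s t c. s < n \<Longrightarrow> t < n \<Longrightarrow> c < m \<Longrightarrow> e s t c = e t s c"
  shows "block_mat m n G \<in> hermitian_mats (m * n)"
proof -
  have herm: "block_mat m n G $$ (a, b) = cnj (block_mat m n G $$ (b, a))" if "a < m * n" "b < m * n" for a b
    using that block_index_bounds[OF that(1)] block_index_bounds[OF that(2)]
    by (simp add: block_mat_def G index_unitary_conj_real_diag[OF U] sym[of "a div m" "b div m"] mult_ac)
  have "mat_adjoint (block_mat m n G) = block_mat m n G"
  proof (intro eq_matI)
    fix a b assume "a < dim_row (block_mat m n G)" "b < dim_col (block_mat m n G)"
    then have ab: "a < m * n" "b < m * n" by (simp_all add: block_mat_def)
    then have "mat_adjoint (block_mat m n G) $$ (a, b) = cnj (block_mat m n G $$ (b, a))"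
      by (intro index_mat_adjoint) (simp_all add: block_mat_def)
    also have "\<dots> = block_mat m n G $$ (a, b)" by (rule herm[OF ab, symmetric])
    finally show "mat_adjoint (block_mat m n G) $$ (a, b) = block_mat m n G $$ (a, b)" .
  qed (simp_all add: block_mat_def)
  then show ?thesis by (simp add: hermitian_mats_def block_mat_def)
qed

text \<open>
  The form of the block matrix is a sum of forms of the arrays of eigenvalues. To isolate the array
  with index \<open>c\<close>, test with vectors whose blocks are all real multiples of the \<open>c\<close>-th column of \<open>U\<close>.
\<close>
lemma block_mat_psd_iff:
  assumes U: "U \<in> unitary_mats m"
    and G: "\<And>s t. s < n \<Longrightarrow> t < n \<Longrightarrow> G s t = unitary_conj U (real_diag m (e s t))"
    and sym: "\<And>s t c. s < n \<Longrightarrow> t < n \<Longrightarrow> c < m \<Longrightarrow> e s t c = e t s c"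
  shows "block_mat m n G \<in> psd_mats (m * n) UNIV \<longleftrightarrow> (\<forall>c<m. pos_semidef n (\<lambda>s t. e s t c))"
proof -
  have form: "Re ((block_mat m n G *\<^sub>v x) \<bullet>c x)
    = (\<Sum>c<m. quad_form n (\<lambda>s t. e s t c) (\<lambda>s. Re (eigen_coord m U x s c))
        + quad_form n (\<lambda>s t. e s t c) (\<lambda>s. Im (eigen_coord m U x s c)))"
    if "x \<in> carrier_vec (m * n)" for x
    using U G that by (rule block_form_eigen_coord)
  show ?thesis
  proof
    assume psd: "block_mat m n G \<in> psd_mats (m * n) UNIV"
    show "\<forall>c<m. pos_semidef n (\<lambda>s t. e s t c)"
    proof (intro allI impI pos_semidefI)
      fix c r assume c: "c < m"
      define x where "x = vec (m * n) (\<lambda>a. complex_of_real (r (a div m)) * U $$ (a mod m, c))"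
      have x: "x \<in> carrier_vec (m * n)" by (simp add: x_def)
      have y: "eigen_coord m U x s b = (if b = c then complex_of_real (r s) else 0)" if "s < n" "b < m" for s b
      proof -
        have "s * m + j < m * n" if "j < m" for j using \<open>s < n\<close> that by (rule block_index_less)
        then have "eigen_coord m U x s b
            = (\<Sum>j<m. complex_of_real (r s) * (cnj (U $$ (j, b)) * U $$ (j, c)))"
          unfolding eigen_coord_def by (intro sum.cong) (auto simp: x_def)
        also have "\<dots> = complex_of_real (r s) * (mat_adjoint U * U) $$ (b, c)"
          using unitary_mats_carrier[OF U] that c
          by (simp add: scalar_prod_def index_mat_adjoint atLeast0LessThan sum_distrib_left)
        also have "mat_adjoint U * U = 1\<^sub>m m" using U by (simp add: unitary_mats_def)
        finally show ?thesis using that c by simp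
      qed
      have zero: "quad_form n (\<lambda>s t. e s t b) (\<lambda>_. 0) = 0" for b by (simp add: quad_form_def)
      have "Re ((block_mat m n G *\<^sub>v x) \<bullet>c x)
          = (\<Sum>b<m. quad_form n (\<lambda>s t. e s t b) (\<lambda>s. if b = c then r s else 0))"
        unfolding form[OF x]
      proof (intro sum.cong refl)
        fix b assume "b \<in> {..<m}"
        then have "quad_form n (\<lambda>s t. e s t b) (\<lambda>s. Re (eigen_coord m U x s b))
            = quad_form n (\<lambda>s t. e s t b) (\<lambda>s. if b = c then r s else 0)"
          "quad_form n (\<lambda>s t. e s t b) (\<lambda>s. Im (eigen_coord m U x s b))
            = quad_form n (\<lambda>s t. e s t b) (\<lambda>_. 0)"
          by (auto intro!: quad_form_cong simp: y)
        then show "quad_form n (\<lambda>s t. e s t b) (\<lambda>s. Re (eigen_coord m U x s b))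
            + quad_form n (\<lambda>s t. e s t b) (\<lambda>s. Im (eigen_coord m U x s b))
          = quad_form n (\<lambda>s t. e s t b) (\<lambda>s. if b = c then r s else 0)" by (simp add: zero)
      qed
      also have "\<dots> = (\<Sum>b<m. if b = c then quad_form n (\<lambda>s t. e s t c) r else 0)"
        by (intro sum.cong) (auto simp: zero)
      also have "\<dots> = quad_form n (\<lambda>s t. e s t c) r" using c by simp
      finally show "0 \<le> quad_form n (\<lambda>s t. e s t c) r"
        using psd x by (auto simp: psd_mats_def)
    qed (use sym in auto)
  next
    assume "\<forall>c<m. pos_semidef n (\<lambda>s t. e s t c)"
    then have "0 \<le> Re ((block_mat m n G *\<^sub>v x) \<bullet>c x)" if "x \<in> carrier_vec (m * n)" for x
      unfolding form[OF that]
      by (intro sum_nonneg add_nonneg_nonneg) (auto intro: pos_semidef_quad_form)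
    then show "block_mat m n G \<in> psd_mats (m * n) UNIV"
      using block_mat_hermitian[OF U, of n G e] G sym by (simp add: psd_mats_def)
  qed
qed

lemma spectral_calc_unitary_conj:
  assumes "U \<in> unitary_mats m"
  shows "spectral_calc f (unitary_conj U (real_diag m d)) = unitary_conj U (real_diag m (f \<circ> d))"
proof -
  have dim: "dim_row (unitary_conj U (real_diag m d)) = m"
    using unitary_conj_carrier[OF assms real_diag_carrier] by auto
  with assms have "spectral_decomp (unitary_conj U (real_diag m d)) U d"
    by (simp add: spectral_decomp_def unitary_conj_def)
  from spectral_calc_eq[OF this, of f] show ?thesis
    by (simp only: dim unitary_conj_def[of U "real_diag m (f \<circ> d)"])
qed

text \<open>
  Blocks of a Hermitian block matrix which are Hermitian themselves satisfy \<open>H s t = H t s\<close>; this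
  makes the arrays of eigenvalues symmetric.
\<close>
lemma block_calc_psd:
  assumes f: "\<And>A. pos_semidef n A \<Longrightarrow> pos_semidef n (\<lambda>i j. f (A i j))"
    and H: "blocks_in n H (hermitian_mats m)" "blocks_commute n H"
      "block_mat m n H \<in> psd_mats (m * n) UNIV"
  shows "block_calc f m n H \<in> psd_mats (m * n) UNIV"
proof -
  define F where "F = (\<lambda>(s, t). H s t) ` ({..<n} \<times> {..<n})"
  have "simultaneously_diagonalizable m F"
    using H(1,2) unfolding F_def blocks_in_def blocks_commute_def
    by (intro commuting_hermitian_simultaneously_diagonalizable) auto
  then obtain U where U: "U \<in> unitary_mats m"
    and "\<forall>B\<in>F. \<exists>d. B = unitary_conj U (real_diag m d)"
    unfolding simultaneously_diagonalizable_def by blast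
  then have "\<forall>s t. \<exists>d. s < n \<longrightarrow> t < n \<longrightarrow> H s t = unitary_conj U (real_diag m d)"
    unfolding F_def by auto
  then obtain d where d: "\<And>s t. s < n \<Longrightarrow> t < n \<Longrightarrow> H s t = unitary_conj U (real_diag m (d s t))"
    by metis
  have sym: "d s t c = d t s c" if st: "s < n" "t < n" and c: "c < m" for s t c
  proof -
    have Hst: "H s t \<in> hermitian_mats m" "H t s \<in> hermitian_mats m"
      using H(1) st by (auto simp: blocks_in_def)
    note Hc = Hst[THEN hermitian_mats_carrier]
    have "H s t = H t s"
    proof (rule eq_matI)
      fix i j assume "i < dim_row (H t s)" "j < dim_col (H t s)"
      then have ij: "i < m" "j < m" using Hc by auto
      let ?B = "block_mat m n H"
      have B: "?B \<in> carrier_mat (m * n) (m * n)" "mat_adjoint ?B = ?B"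
        using H(3) by (auto simp: psd_mats_def hermitian_mats_def)
      have "H s t $$ (i, j) = cnj (H t s $$ (j, i))"
        using index_mat_adjoint[of "s * m + i" ?B "t * m + j"] B block_index_less[OF st(1) ij(1)] block_index_less[OF st(2) ij(2)]
        by (simp add: index_block_mat st ij)
      also have "\<dots> = H t s $$ (i, j)"
        using index_mat_adjoint[of i "H t s" j] Hst(2) Hc ij by (simp add: hermitian_mats_def)
      finally show "H s t $$ (i, j) = H t s $$ (i, j)" .
    qed (use Hc in auto)
    then have "unitary_conj (mat_adjoint U) (unitary_conj U (real_diag m (d s t)))
        = unitary_conj (mat_adjoint U) (unitary_conj U (real_diag m (d t s)))"
      using d st by simp
    then have "real_diag m (d s t) = real_diag m (d t s)"
      by (simp add: unitary_conj_inverse(1)[OF U] real_diag_carrier)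
    from arg_cong[OF this, of "\<lambda>M. M $$ (c, c)"] show ?thesis
      using c by (simp add: real_diag_def mat_diag_def)
  qed
  have "block_mat m n H \<in> psd_mats (m * n) UNIV \<longleftrightarrow> (\<forall>c<m. pos_semidef n (\<lambda>s t. d s t c))"
    using U d sym by (rule block_mat_psd_iff)
  then have "\<forall>c<m. pos_semidef n (\<lambda>s t. d s t c)" using H(3) by blast
  then have "\<forall>c<m. pos_semidef n (\<lambda>s t. (f \<circ> d s t) c)" using f by simp
  moreover have "block_calc f m n H = block_mat m n (\<lambda>s t. unitary_conj U (real_diag m (f \<circ> d s t)))"
    unfolding block_calc_def by (rule block_mat_cong) (simp add: d spectral_calc_unitary_conj[OF U])
  ultimately show ?thesis
    using block_mat_psd_iff[OF U, where e = "\<lambda>s t. f \<circ> d s t" and n = n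
        and G = "\<lambda>s t. unitary_conj U (real_diag m (f \<circ> d s t))"] sym by simp
qed

text \<open>Scalar blocks commute, and all their arrays of eigenvalues coincide with the given array.\<close>
lemma block_calc_not_psd:
  assumes A: "pos_semidef n A" "\<not> pos_semidef n (\<lambda>i j. f (A i j))" and m: "0 < m"
  shows "\<exists>H. blocks_in n H (real_symmetric_mats m) \<and> blocks_commute n H \<and>
    block_mat m n H \<in> psd_mats (m * n) \<real> \<and> block_calc f m n H \<notin> psd_mats (m * n) \<real>"
proof -
  define H where "H s t = real_diag m (\<lambda>_. A s t)" for s t
  have one: "1\<^sub>m m \<in> unitary_mats m" by (simp add: unitary_matsI mat_adjoint_one)
  have conj_one: "unitary_conj (1\<^sub>m m) (real_diag m d) = real_diag m d" for d
    using real_diag_carrier[of m d] by (simp add: unitary_conj_def mat_adjoint_one)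
  have entry: "H s t $$ (i, j) = (if i = j then complex_of_real (A s t) else 0)" if "i < m" "j < m" for s t i j
    using that by (simp add: H_def real_diag_def mat_diag_def)
  have Hc: "H s t \<in> carrier_mat m m" for s t by (simp add: H_def real_diag_carrier)
  have dims: "dim_row (H s t) = m" "dim_col (H s t) = m" for s t using Hc[of s t] by auto
  have "blocks_in n H (real_symmetric_mats m)"
    unfolding blocks_in_def real_symmetric_mats_def
    using Hc by (auto simp: elements_mat_def entry dims intro!: eq_matI)
  moreover have "blocks_commute n H"
    unfolding blocks_commute_def H_def by (simp add: real_diag_mult mult.commute)
  moreover have "block_mat m n H \<in> psd_mats (m * n) \<real>"
  proof -
    have "block_mat m n H \<in> psd_mats (m * n) UNIV"
      using A(1) pos_semidef_sym[OF A(1)]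
        block_mat_psd_iff[OF one, where G = H and e = "\<lambda>s t _. A s t" and n = n]
      by (simp add: conj_one H_def)
    moreover have "elements_mat (block_mat m n H) \<subseteq> \<real>"
      by (auto simp: elements_mat_def block_mat_def entry block_index_bounds)
    ultimately show ?thesis by (simp add: psd_mats_def)
  qed
  moreover have "block_calc f m n H \<notin> psd_mats (m * n) \<real>"
  proof
    assume "block_calc f m n H \<in> psd_mats (m * n) \<real>"
    moreover have "block_calc f m n H = block_mat m n (\<lambda>s t. real_diag m (\<lambda>_. f (A s t)))"
      unfolding block_calc_def H_def
      using spectral_calc_unitary_conj[OF one, of f] by (simp add: conj_one comp_def)
    ultimately have "block_mat m n (\<lambda>s t. real_diag m (\<lambda>_. f (A s t))) \<in> psd_mats (m * n) UNIV"
      by (auto simp: psd_mats_def)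
    then have "\<forall>c<m. pos_semidef n (\<lambda>s t. f (A s t))"
      using pos_semidef_sym[OF A(1)]
        block_mat_psd_iff[OF one, where G = "\<lambda>s t. real_diag m (\<lambda>_. f (A s t))"
          and e = "\<lambda>s t _. f (A s t)" and n = n]
      by (simp add: conj_one)
    then show False using A(2) m by blast
  qed
  ultimately show ?thesis by blast
qed

section \<open>The power functions on commuting Hermitian blocks\<close>

theorem theorem5p1:
  fixes \<alpha> :: real and m n :: nat
  assumes "\<alpha> \<noteq> 0" and "2 \<le> m" and "2 \<le> n"
  shows
    "(\<alpha> \<in> {2 * real k |k. 1 \<le> k} \<union> {real n - 2..} \<longrightarrow>
        (\<forall>H. blocks_in n H (hermitian_mats m) \<and> blocks_commute n H \<and>
             block_mat m n H \<in> psd_mats (m * n) UNIV \<longrightarrow>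
             block_calc (phi \<alpha>) m n H \<in> psd_mats (m * n) UNIV)) \<and>
     (\<alpha> \<notin> {2 * real k |k. 1 \<le> k} \<union> {real n - 2..} \<longrightarrow>
        (\<exists>H. blocks_in n H (real_symmetric_mats m) \<and> blocks_commute n H \<and>
             block_mat m n H \<in> psd_mats (m * n) \<real> \<and>
             block_calc (phi \<alpha>) m n H \<notin> psd_mats (m * n) \<real>)) \<and>
     (\<alpha> \<in> {- 1 + 2 * real k |k. 1 \<le> k} \<union> {real n - 2..} \<longrightarrow>
        (\<forall>H. blocks_in n H (hermitian_mats m) \<and> blocks_commute n H \<and>
             block_mat m n H \<in> psd_mats (m * n) UNIV \<longrightarrow>
             block_calc (psi \<alpha>) m n H \<in> psd_mats (m * n) UNIV)) \<and>
     (\<alpha> \<notin> {- 1 + 2 * real k |k. 1 \<le> k} \<union> {real n - 2..} \<longrightarrow>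
        (\<exists>H. blocks_in n H (real_symmetric_mats m) \<and> blocks_commute n H \<and>
             block_mat m n H \<in> psd_mats (m * n) \<real> \<and>
             block_calc (psi \<alpha>) m n H \<notin> psd_mats (m * n) \<real>))"
proof (intro conjI impI)
  assume \<alpha>: "\<alpha> \<in> {2 * real k |k. 1 \<le> k} \<union> {real n - 2..}"
  have "pos_semidef n (\<lambda>i j. phi \<alpha> (A i j))" if A: "pos_semidef n A" for A
  proof (cases "real n - 2 \<le> \<alpha>")
    case True
    then show ?thesis using pos_semidef_powers(1) assms(3) A by blast
  next
    case False
    then obtain k where "\<alpha> = real (2 * k)" "0 < k" using \<alpha> by auto
    then show ?thesis
      using pos_semidef_power[OF A, of "2 * k"] by (simp only: phi_nat) (simp add: power_even_abs)
  qed
  then show "\<forall>H. blocks_in n H (hermitian_mats m) \<and> blocks_commute n H \<and>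
      block_mat m n H \<in> psd_mats (m * n) UNIV \<longrightarrow> block_calc (phi \<alpha>) m n H \<in> psd_mats (m * n) UNIV"
    using block_calc_psd by blast
next
  assume \<alpha>: "\<alpha> \<notin> {2 * real k |k. 1 \<le> k} \<union> {real n - 2..}"
  have "\<exists>A. pos_semidef n A \<and> \<not> pos_semidef n (\<lambda>i j. phi \<alpha> (A i j))"
  proof (rule power_not_pos_semidef)
    fix k assume k: "0 < k" "\<alpha> = real k"
    have "odd k"
    proof
      assume "even k"
      then obtain l where "k = 2 * l" by (rule evenE)
      then have "\<alpha> = 2 * real l" "1 \<le> l" using k by auto
      then show False using \<alpha> by auto
    qed
    then show "\<forall>t. phi \<alpha> t = sgn t * t ^ k" unfolding k(2) by (simp add: phi_nat_odd)
  qed (use assms \<alpha> in \<open>auto simp: phi_def\<close>)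
  then show "\<exists>H. blocks_in n H (real_symmetric_mats m) \<and> blocks_commute n H \<and>
      block_mat m n H \<in> psd_mats (m * n) \<real> \<and> block_calc (phi \<alpha>) m n H \<notin> psd_mats (m * n) \<real>"
    using block_calc_not_psd[of n _ "phi \<alpha>" m] assms(2) by auto
next
  assume \<alpha>: "\<alpha> \<in> {- 1 + 2 * real k |k. 1 \<le> k} \<union> {real n - 2..}"
  have "pos_semidef n (\<lambda>i j. psi \<alpha> (A i j))" if A: "pos_semidef n A" for A
  proof (cases "real n - 2 \<le> \<alpha>")
    case True
    then show ?thesis using pos_semidef_powers(2) assms(3) A by blast
  next
    case False
    then obtain k where k: "\<alpha> = - 1 + 2 * real k" "1 \<le> k" using \<alpha> by auto
    then have "\<alpha> = real (2 * k - 1)" by (simp add: of_nat_diff)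
    moreover have "odd (2 * k - 1)" using k(2) by simp
    ultimately show ?thesis
      using pos_semidef_power[OF A, of "2 * k - 1"] by (simp only: psi_nat_odd[OF \<open>odd (2 * k - 1)\<close>])
  qed
  then show "\<forall>H. blocks_in n H (hermitian_mats m) \<and> blocks_commute n H \<and>
      block_mat m n H \<in> psd_mats (m * n) UNIV \<longrightarrow> block_calc (psi \<alpha>) m n H \<in> psd_mats (m * n) UNIV"
    using block_calc_psd by blast
next
  assume \<alpha>: "\<alpha> \<notin> {- 1 + 2 * real k |k. 1 \<le> k} \<union> {real n - 2..}"
  have "\<exists>A. pos_semidef n A \<and> \<not> pos_semidef n (\<lambda>i j. psi \<alpha> (A i j))"
  proof (rule power_not_pos_semidef)
    fix k assume k: "0 < k" "\<alpha> = real k"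
    have "even k"
    proof (rule ccontr)
      assume "odd k"
      then obtain l where "k = 2 * l + 1" by (rule oddE)
      then have "\<alpha> = - 1 + 2 * real (Suc l)" using k by simp
      then have "\<exists>l. \<alpha> = - 1 + 2 * real l \<and> 1 \<le> l" by (intro exI[of _ "Suc l"]) auto
      then show False using \<alpha> by auto
    qed
    then show "\<forall>t. psi \<alpha> t = sgn t * t ^ k" unfolding k(2) using k(1) by (simp add: psi_nat_even)
  qed (use assms \<alpha> in \<open>auto simp: psi_def\<close>)
  then show "\<exists>H. blocks_in n H (real_symmetric_mats m) \<and> blocks_commute n H \<and>
      block_mat m n H \<in> psd_mats (m * n) \<real> \<and> block_calc (psi \<alpha>) m n H \<notin> psd_mats (m * n) \<real>"
    using block_calc_not_psd[of n _ "psi \<alpha>" m] assms(2) by auto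
qed

end
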